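(* Let $p$ be a prime, let $K$ be a finite extension of $\mathbb{F}_p(t)$, and let $\varphi \in K(z)$ have $\deg \varphi > 1$. Suppose that $\varphi$ is not isotrivial and that $\beta\in\mathbb{P}^1(K)$ is not exceptional for $\varphi$. Then for all sufficiently large $n$ the set $\varphi^{-n}(\beta)$ is not an isotrivial set.
   Context: $\varphi^{-n}(\beta)$ is the set of $\gamma\in\mathbb{P}^1(\overline K)=\overline K\cup\{\infty\}$ with $\varphi^n(\gamma)=\beta$, where $\varphi^n$ is the $n$-th iterate. A rational function $\varphi\in K(z)$ is isotrivial if there is $\sigma \in \overline{K}(z)$ of degree $1$ with $\sigma\circ\varphi\circ\sigma^{-1}\in\overline{\mathbb{F}}_p(z)$. A finite subset $\mathcal S$ of $\overline K\cup\{\infty\}$ is an isotrivial set if there is $\sigma\in\overline K(z)$ of degree $1$ such that $\sigma(\mathcal S)\subseteq\overline{\mathbb{F}}_p\cup\{\infty\}$. A point $\beta\in\mathbb{P}^1(K)$ is exceptional for $\varphi$ if its total orbit (both forward and backward), i.e. the set of all $\gamma\in\mathbb{P}^1(\overline K)$ with $\varphi^n(\beta)=\gamma$ or $\varphi^n(\gamma)=\beta$ for some $n\ge 0$, is finite. *)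

theory Defs
  imports
    "HOL-Algebra.Algebraic_Closure_Type"
    "HOL-Computational_Algebra.Computational_Algebra"
    "Berlekamp_Zassenhaus.Finite_Field"
begin

text \<open>
  A finite extension of fields is given by the embedding \<open>h\<close> of the base field. In particular,
  if \<open>'p\<close> is a type of prime cardinality \<open>p\<close>, then \<open>'p mod_ring poly fract\<close> is the field
  \<open>F\<^sub>p(t)\<close>, and \<open>h :: 'p mod_ring poly fract \<Rightarrow> 'k\<close> makes \<open>'k\<close> a finite extension of it.
\<close>
definition finite_field_extension :: "('f::field \<Rightarrow> 'k::field) \<Rightarrow> bool" where
  "finite_field_extension h \<longleftrightarrow>
     field_hom h \<and> (\<exists>B. finite B \<and> module.span (\<lambda>c x. h c * x) B = UNIV)"

text \<open>
  For a field of characteristic \<open>p\<close>, \<open>\<int>\<close> (the image of the integers) is the prime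
  field with \<open>p\<close> elements. In the algebraic closure of such a field the following set is therefore
  the algebraic closure of the prime field.
\<close>
definition prime_field_closure :: "'a::field set" where
  "prime_field_closure = {x. \<exists>q. q \<noteq> 0 \<and> (\<forall>i. Polynomial.coeff q i \<in> \<int>) \<and> poly q x = 0}"


subsection \<open>Rational functions\<close>

type_synonym 'a ratfun = "'a poly fract"

lemma ratfun_lowest_terms_ex1:
  fixes \<phi> :: "'a::field ratfun"
  shows "\<exists>!(f, g). \<phi> = Fraction_Field.Fract f g \<and> Rings.coprime f g \<and> Polynomial.lead_coeff g = 1"
proof -
  define D where "D = (\<lambda>n. \<exists>a b. b \<noteq> 0 \<and> Polynomial.degree b = n \<and> \<phi> = Fraction_Field.Fract a b)"
  obtain a0 b0 where "b0 \<noteq> 0" "\<phi> = Fraction_Field.Fract a0 b0"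
    by (cases \<phi>) auto
  hence "D (Polynomial.degree b0)" unfolding D_def by blast
  hence L: "D (LEAST n. D n)" by (rule LeastI)
  then obtain a1 b1 where b1: "b1 \<noteq> 0" "Polynomial.degree b1 = (LEAST n. D n)"
    "\<phi> = Fraction_Field.Fract a1 b1" unfolding D_def by blast
  define c where "c = inverse (Polynomial.lead_coeff b1)"
  have c: "c \<noteq> 0" using b1(1) by (simp add: c_def)
  define a b where "a = Polynomial.smult c a1" and "b = Polynomial.smult c b1"
  have b: "b \<noteq> 0" "Polynomial.degree b = (LEAST n. D n)" "Polynomial.lead_coeff b = 1"
    using b1(1) c by (simp_all add: b_def b1(2)[symmetric] c_def)
  have ab: "\<phi> = Fraction_Field.Fract a b"
    using b1 b c by (simp add: a_def b_def eq_fract)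
  have min: "Polynomial.degree b \<le> Polynomial.degree g"
    if "g \<noteq> 0" "\<phi> = Fraction_Field.Fract f g" for f g
    unfolding b(2) by (rule Least_le) (use that in \<open>auto simp: D_def\<close>)
  have mult: "\<exists>q. f = q * a \<and> g = q * b" if fg: "g \<noteq> 0" "\<phi> = Fraction_Field.Fract f g" for f g
  proof -
    have eq: "f * b = a * g" using ab fg b by (simp add: eq_fract)
    define r s where "r = g mod b" and "s = f - g div b * a"
    have g: "g = g div b * b + r" by (simp add: r_def)
    have "s * b = f * b - g div b * a * b" by (simp add: s_def algebra_simps)
    also have "\<dots> = a * (g - g div b * b)" unfolding eq by (simp add: algebra_simps)
    also have "g - g div b * b = r" using g by (simp add: algebra_simps)
    finally have sb: "s * b = a * r" .
    have "r = 0"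
    proof (rule ccontr)
      assume "r \<noteq> 0"
      hence "\<phi> = Fraction_Field.Fract s r" using ab sb b by (simp add: eq_fract)
      hence "Polynomial.degree b \<le> Polynomial.degree r" using min \<open>r \<noteq> 0\<close> by blast
      moreover have "Polynomial.degree r < Polynomial.degree b"
        using \<open>r \<noteq> 0\<close> b(1) degree_mod_less[of b g] by (auto simp: r_def)
      ultimately show False by simp
    qed
    hence "s = 0" using sb b by simp
    thus ?thesis using g \<open>r = 0\<close> by (intro exI[of _ "g div b"]) (simp add: s_def)
  qed
  have cop: "Rings.coprime a b"
  proof (rule coprimeI)
    fix d assume "d dvd a" "d dvd b"
    then obtain a' b' where d: "a = d * a'" "b = d * b'" by (elim dvdE)
    have nz: "d \<noteq> 0" "b' \<noteq> 0" using b d by auto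
    have "\<phi> = Fraction_Field.Fract a' b'" using ab b d nz by (simp add: eq_fract)
    from min[OF nz(2) this] have "Polynomial.degree d = 0"
      using nz by (simp add: d degree_mult_eq)
    thus "is_unit d" using nz by (simp add: is_unit_iff_degree)
  qed
  have "f = a \<and> g = b"
    if fg: "\<phi> = Fraction_Field.Fract f g" "Rings.coprime f g" "Polynomial.lead_coeff g = 1" for f g
  proof -
    have "g \<noteq> 0" using fg(3) by auto
    from mult[OF this fg(1)] obtain q where q: "f = q * a" "g = q * b" by blast
    hence "is_unit q" using fg(2) by (meson coprime_common_divisor dvd_triv_left)
    hence "Polynomial.degree q = 0" using is_unit_iff_degree by fastforce
    moreover have "Polynomial.lead_coeff q = 1" using q(2) fg(3) b(3) by (simp add: lead_coeff_mult)
    ultimately have "q = 1" by (metis degree_eq_zeroE lead_coeff_pCons(2) one_pCons)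
    thus ?thesis using q by simp
  qed
  thus ?thesis using ab cop b(3) by (intro ex1I[of _ "(a, b)"]) auto
qed

definition ratfun_lowest_terms :: "'a::field ratfun \<Rightarrow> 'a poly \<times> 'a poly" where
  "ratfun_lowest_terms \<phi> =
     (THE (f, g). \<phi> = Fraction_Field.Fract f g \<and> Rings.coprime f g \<and> Polynomial.lead_coeff g = 1)"

definition ratfun_num :: "'a::field ratfun \<Rightarrow> 'a poly" where
  "ratfun_num \<phi> = fst (ratfun_lowest_terms \<phi>)"

definition ratfun_den :: "'a::field ratfun \<Rightarrow> 'a poly" where
  "ratfun_den \<phi> = snd (ratfun_lowest_terms \<phi>)"

definition ratfun_degree :: "'a::field ratfun \<Rightarrow> nat" where
  "ratfun_degree \<phi> = max (Polynomial.degree (ratfun_num \<phi>)) (Polynomial.degree (ratfun_den \<phi>))"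

definition ratfun_id :: "'a::field ratfun" where
  "ratfun_id = to_fract [:0, 1:]"

text \<open>
  \<open>ratfun_comp \<phi> \<psi>\<close> is \<open>\<phi> \<circ> \<psi>\<close>, obtained by evaluating numerator and denominator of \<open>\<phi>\<close> at
  the element \<open>\<psi>\<close> of the field of rational functions. The denominator can vanish
  only if \<open>\<psi>\<close> is constant.
\<close>
definition ratfun_comp :: "'a::field ratfun \<Rightarrow> 'a ratfun \<Rightarrow> 'a ratfun" where
  "ratfun_comp \<phi> \<psi> =
     poly (map_poly (\<lambda>c. to_fract [:c:]) (ratfun_num \<phi>)) \<psi> /
     poly (map_poly (\<lambda>c. to_fract [:c:]) (ratfun_den \<phi>)) \<psi>"

definition ratfuns_over :: "'a::field set \<Rightarrow> 'a ratfun set" where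
  "ratfuns_over F = {Fraction_Field.Fract f g | f g.
     g \<noteq> 0 \<and> (\<forall>i. Polynomial.coeff f i \<in> F) \<and> (\<forall>i. Polynomial.coeff g i \<in> F)}"

definition ratfun_to_ac :: "'k::field ratfun \<Rightarrow> 'k alg_closure ratfun" where
  "ratfun_to_ac \<phi> =
     Fraction_Field.Fract (map_poly to_ac (ratfun_num \<phi>)) (map_poly to_ac (ratfun_den \<phi>))"


subsection \<open>The projective line\<close>

datatype 'a P1 = Fin 'a | Infty

text \<open>
  At \<open>\<infinity>\<close>, the value is the quotient of the coefficients of \<open>z ^ d\<close> in numerator and
  denominator, where \<open>d\<close> is the degree of \<open>\<phi>\<close>.
\<close>
definition ratfun_eval :: "'a::field ratfun \<Rightarrow> 'a P1 \<Rightarrow> 'a P1" where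
  "ratfun_eval \<phi> x =
     (let f = ratfun_num \<phi>; g = ratfun_den \<phi>; d = ratfun_degree \<phi>;
          quot = (\<lambda>a b. if b = 0 then Infty else Fin (a / b))
      in case x of
           Fin z \<Rightarrow> quot (poly f z) (poly g z)
         | Infty \<Rightarrow> quot (Polynomial.coeff f d) (Polynomial.coeff g d))"

abbreviation P1_to_ac :: "'k::field P1 \<Rightarrow> 'k alg_closure P1" where
  "P1_to_ac \<equiv> map_P1 to_ac"

definition iterated_preimage :: "'k::field ratfun \<Rightarrow> nat \<Rightarrow> 'k P1 \<Rightarrow> 'k alg_closure P1 set" where
  "iterated_preimage \<phi> n \<beta> = {\<gamma>. (ratfun_eval (ratfun_to_ac \<phi>) ^^ n) \<gamma> = P1_to_ac \<beta>}"

definition exceptional :: "'k::field ratfun \<Rightarrow> 'k P1 \<Rightarrow> bool" where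
  "exceptional \<phi> \<beta> \<longleftrightarrow>
     finite {\<gamma>. \<exists>n. (ratfun_eval (ratfun_to_ac \<phi>) ^^ n) (P1_to_ac \<beta>) = \<gamma> \<or>
                     (ratfun_eval (ratfun_to_ac \<phi>) ^^ n) \<gamma> = P1_to_ac \<beta>}"


subsection \<open>Isotriviality\<close>

text \<open>Here \<open>\<tau>\<close> is the compositional inverse of \<open>\<sigma>\<close>.\<close>
definition isotrivial :: "'k::field ratfun \<Rightarrow> bool" where
  "isotrivial \<phi> \<longleftrightarrow>
     (\<exists>\<sigma> \<tau> :: 'k alg_closure ratfun. ratfun_degree \<sigma> = 1 \<and>
        ratfun_comp \<sigma> \<tau> = ratfun_id \<and> ratfun_comp \<tau> \<sigma> = ratfun_id \<and>
        ratfun_comp (ratfun_comp \<sigma> (ratfun_to_ac \<phi>)) \<tau> \<in> ratfuns_over prime_field_closure)"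

definition isotrivial_set :: "'k::field alg_closure P1 set \<Rightarrow> bool" where
  "isotrivial_set S \<longleftrightarrow> finite S \<and>
     (\<exists>\<sigma> :: 'k alg_closure ratfun. ratfun_degree \<sigma> = 1 \<and>
        ratfun_eval \<sigma> ` S \<subseteq> Fin ` prime_field_closure \<union> {Infty})"

end

theory Submission
  imports Defs
begin

text \<open>
  Let \<open>k\<close> be the algebraic closure of the prime field in \<open>L\<close>, the algebraic closure of \<open>K\<close>.
  Call \<open>W \<subseteq> P\<^sup>1(L)\<close> a \<open>k\<close>-structure if a Moebius map takes it to \<open>P\<^sup>1(k)\<close>; two \<open>k\<close>-structures
  sharing three points are equal. If the fibres of \<open>\<phi>\<close> over three points of a \<open>k\<close>-structure \<open>U\<close>
  lie in a \<open>k\<close>-structure \<open>W\<close>, then \<open>\<phi>\<close> is defined over \<open>k\<close> in suitable coordinates and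
  \<open>\<phi>\<^sup>-\<^sup>1(U) = W\<close>. So if infinitely many of the preimages of \<open>\<beta>\<close> are isotrivial sets, then (once they have
  at least three points) they lie in unique \<open>k\<close>-structures \<open>W\<^sub>n\<close> with \<open>\<phi>\<^sup>-\<^sup>1(W\<^sub>n) = W\<^sub>n\<^sub>+\<^sub>1\<close>, and \<open>\<phi>\<close> is
  isotrivial as soon as some \<open>k\<close>-structure is totally invariant. The branch points of \<open>\<phi>\<close> lie in all
  \<open>W\<^sub>n\<close>, and the set \<open>V\<close> of points in almost all \<open>W\<^sub>n\<close> is totally invariant. If \<open>V\<close> has three points, then the
  sequence \<open>W\<^sub>n\<close> is eventually constant; if it has two, then \<open>\<phi>\<close> is conjugate to \<open>c z\<^sup>d\<close> or \<open>c z\<^sup>-\<^sup>d\<close>; if it has one,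
  then \<open>\<phi>\<close> is a polynomial whose only branch point is \<open>\<infinity>\<close>, and a direct computation applies. Purely
  inseparable maps, which have no branch points, are isotrivial because they are injective
  and have three fixed points.
\<close>

section \<open>The algebraic closure of the prime field\<close>

locale alg_closed_char_p =
  fixes field_type :: "'a::alg_closed_field itself"
  assumes CHAR_pos: "CHAR('a) > 0"
begin

lemma prime_CHAR: "prime CHAR('a)"
  using CHAR_pos prime_CHAR_semidom by blast

section \<open>Powers of Frobenius\<close>

lemma frob_add: "(x + y :: 'a) ^ CHAR('a) ^ n = x ^ CHAR('a) ^ n + y ^ CHAR('a) ^ n"
  by (rule freshmans_dream'[OF prime_CHAR refl])

lemma frob_minus: "(- x :: 'a) ^ CHAR('a) ^ n = - (x ^ CHAR('a) ^ n)"
proof -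
  have "x ^ CHAR('a) ^ n + (- x) ^ CHAR('a) ^ n = 0"
    using frob_add[of x "- x" n] CHAR_pos by (simp add: power_0_left)
  thus ?thesis by (simp add: add_eq_0_iff)
qed

lemma frob_diff: "(x - y :: 'a) ^ CHAR('a) ^ n = x ^ CHAR('a) ^ n - y ^ CHAR('a) ^ n"
  using frob_add[of x "- y" n] by (simp add: frob_minus)

lemma frob_inj: "x ^ CHAR('a) ^ n = y ^ CHAR('a) ^ n \<longleftrightarrow> x = (y :: 'a)"
  using frob_diff[of x y n] CHAR_pos by auto

lemma frob_poly:
  fixes f :: "'a poly"
  assumes "\<And>i. coeff f i ^ CHAR('a) ^ n = coeff f i"
  shows "poly f x ^ CHAR('a) ^ n = poly f (x ^ CHAR('a) ^ n)"
  unfolding poly_altdef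
  by (subst freshmans_dream_sum'[OF prime_CHAR refl])
     (simp add: power_mult_distrib assms mult.commute flip: power_mult)

lemma Ints_frob:
  assumes "x \<in> (\<int> :: 'a set)" shows "x ^ CHAR('a) ^ n = x"
proof -
  obtain i where i: "x = of_int i" using assms by (auto simp: Ints_def)
  have nat: "(of_nat m :: 'a) ^ CHAR('a) ^ n = of_nat m" for m
    using CHAR_pos by (induction m) (simp_all add: frob_add power_0_left)
  show ?thesis unfolding i
    by (cases i rule: int_cases2) (simp_all add: nat frob_minus)
qed

lemma frob_iterate:
  assumes "(x :: 'a) ^ CHAR('a) ^ n = x" shows "x ^ CHAR('a) ^ (n * m) = x"
proof (induction m)
  case (Suc m)
  have "x ^ CHAR('a) ^ (n * Suc m) = (x ^ CHAR('a) ^ n) ^ CHAR('a) ^ (n * m)"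
    by (simp add: power_add flip: power_mult)
  thus ?case by (simp add: assms Suc)
qed simp

text \<open>The power map sends roots of \<open>f\<close> to roots of \<open>f\<close>, so the orbit
  of \<open>x\<close> repeats; injectivity of Frobenius cancels the preperiod.\<close>

lemma root_frob_fixed:
  fixes f :: "'a poly"
  assumes "f \<noteq> 0" "poly f x = 0" "n > 0" "\<And>i. coeff f i ^ CHAR('a) ^ n = coeff f i"
  shows "\<exists>m>0. x ^ CHAR('a) ^ m = x"
proof -
  define y where "y i = x ^ CHAR('a) ^ (n * i)" for i
  have y_Suc: "y (Suc i) = y i ^ CHAR('a) ^ n" for i
    by (simp add: y_def power_add mult.commute flip: power_mult)
  have root: "poly f (y i) = 0" for i
  proof (induction i)
    case 0 thus ?case using assms by (simp add: y_def)
  next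
    case (Suc i)
    have "poly f (y (Suc i)) = poly f (y i) ^ CHAR('a) ^ n"
      unfolding y_Suc by (rule frob_poly[symmetric]) (rule assms(4))
    thus ?case using Suc CHAR_pos by simp
  qed
  hence "finite (range y)"
    by (intro finite_subset[OF _ poly_roots_finite[OF assms(1)]]) auto
  hence "\<not> inj y" using finite_imageD by fastforce
  then obtain i j where ij: "i < j" "y i = y j"
    unfolding inj_def by (metis nat_neq_iff)
  have "y j = (x ^ CHAR('a) ^ (n * (j - i))) ^ CHAR('a) ^ (n * i)"
  proof -
    have "n * j = n * (j - i) + n * i" using ij by (simp flip: add_mult_distrib2)
    thus ?thesis unfolding y_def by (metis power_add power_mult)
  qed
  hence "x ^ CHAR('a) ^ (n * (j - i)) = x"
    using ij frob_inj unfolding y_def by metis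
  thus ?thesis using ij assms(3) by (intro exI[of _ "n * (j - i)"]) auto
qed

section \<open>The subfield of algebraic constants\<close>

abbreviation (input) k :: "'a set" where "k \<equiv> prime_field_closure"

text \<open>Membership in \<open>k\<close> becomes membership in some finite field, so that closure
  under the field operations follows from exponent rules. For the converse, \<open>x\<close> is a
  root of \<open>z ^ CHAR('a) ^ n - z\<close>.\<close>

lemma k_iff: "x \<in> k \<longleftrightarrow> (\<exists>n>0. x ^ CHAR('a) ^ n = x)"
proof
  assume "x \<in> k"
  then obtain q where "q \<noteq> 0" "\<forall>i. coeff q i \<in> \<int>" "poly q x = 0"
    unfolding prime_field_closure_def by auto
  thus "\<exists>n>0. x ^ CHAR('a) ^ n = x"
    by (intro root_frob_fixed[of q x 1]) (use Ints_frob[of _ 1] in auto)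
next
  assume "\<exists>n>0. x ^ CHAR('a) ^ n = x"
  then obtain n where n: "n > 0" "x ^ CHAR('a) ^ n = x" by auto
  define q :: "'a poly" where "q = monom 1 (CHAR('a) ^ n) - monom 1 1"
  have gt1: "CHAR('a) ^ n > 1"
    by (rule one_less_power[OF prime_gt_1_nat[OF prime_CHAR] n(1)])
  have "coeff q (CHAR('a) ^ n) = 1" using gt1 by (auto simp: q_def)
  hence "q \<noteq> 0" by auto
  moreover have "coeff q i \<in> \<int>" for i by (auto simp: q_def)
  moreover have "poly q x = 0" using n by (simp add: q_def poly_monom)
  ultimately show "x \<in> k" unfolding prime_field_closure_def by blast
qed

lemma k_frob_common:
  assumes "finite A" "A \<subseteq> k" shows "\<exists>n>0. \<forall>x\<in>A. x ^ CHAR('a) ^ n = x"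
  using assms
proof (induction A rule: finite_induct)
  case (insert a A)
  then obtain n m where nm: "n > 0" "\<forall>x\<in>A. x ^ CHAR('a) ^ n = x" "m > 0" "a ^ CHAR('a) ^ m = a"
    by (auto simp: k_iff)
  hence "a ^ CHAR('a) ^ (n * m) = a" "\<forall>x\<in>A. x ^ CHAR('a) ^ (n * m) = x"
    using frob_iterate[of _ n m] frob_iterate[of a m n] by (auto simp: mult.commute)
  thus ?case using nm by (intro exI[of _ "n * m"]) auto
qed auto

lemma k_0 [simp]: "0 \<in> k" and k_1 [simp]: "1 \<in> k"
  using CHAR_pos by (auto simp: k_iff power_0_left intro: exI[of _ 1])

lemma k_add: "x \<in> k \<Longrightarrow> y \<in> k \<Longrightarrow> x + y \<in> k"
  using k_frob_common[of "{x, y}"] by (auto simp: k_iff frob_add)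

lemma k_minus: "x \<in> k \<Longrightarrow> - x \<in> k"
  by (auto simp: k_iff frob_minus)

lemma k_diff: "x \<in> k \<Longrightarrow> y \<in> k \<Longrightarrow> x - y \<in> k"
  using k_add[of x "- y"] k_minus by simp

lemma k_mult: "x \<in> k \<Longrightarrow> y \<in> k \<Longrightarrow> x * y \<in> k"
  using k_frob_common[of "{x, y}"] by (auto simp: k_iff power_mult_distrib)

lemma k_inverse: "x \<in> k \<Longrightarrow> inverse x \<in> k"
  by (auto simp: k_iff power_inverse)

lemma k_divide: "x \<in> k \<Longrightarrow> y \<in> k \<Longrightarrow> x / y \<in> k"
  by (simp add: divide_inverse k_mult k_inverse)

lemma k_power: "x \<in> k \<Longrightarrow> x ^ n \<in> k"
  by (induction n) (auto intro: k_mult)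

lemma k_sum: "(\<And>i. i \<in> A \<Longrightarrow> f i \<in> k) \<Longrightarrow> sum f A \<in> k"
  by (induction A rule: infinite_finite_induct) (auto intro: k_add)

section \<open>Polynomials over the algebraic constants\<close>

definition over_k :: "'a poly \<Rightarrow> bool" where
  "over_k f \<longleftrightarrow> (\<forall>i. coeff f i \<in> k)"

text \<open>One power of Frobenius fixes all coefficients, including the zeros beyond the degree,
  hence a further power fixes the root. In effect \<open>k\<close> is algebraically closed.\<close>

lemma k_root:
  assumes "over_k f" "f \<noteq> 0" "poly f x = 0" shows "x \<in> k"
proof -
  obtain n where n: "n > 0" "\<forall>c\<in>set (coeffs f). c ^ CHAR('a) ^ n = c"
    using k_frob_common[of "set (coeffs f)"] assms(1) range_coeff[of f]
    unfolding over_k_def by (metis finite_set image_subset_iff insert_subset)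
  have "coeff f i \<in> insert 0 (set (coeffs f))" for i
    using range_coeff[of f] by blast
  hence "coeff f i ^ CHAR('a) ^ n = coeff f i" for i
    using n CHAR_pos by (metis insert_iff power_0_left zero_less_power less_numeral_extra(3))
  thus ?thesis using root_frob_fixed[of f x n] assms n by (auto simp: k_iff)
qed

lemma k_nth_root:
  assumes "x ^ n \<in> k" "n > 0" shows "x \<in> k"
proof (rule k_root)
  show "over_k (monom 1 n - [:x ^ n:])"
    using assms by (auto simp: over_k_def coeff_pCons split: nat.split intro!: k_minus k_diff)
  have "coeff (monom 1 n - [:x ^ n:]) n = 1" using assms by (simp add: coeff_pCons split: nat.split)
  thus "monom 1 n - [:x ^ n:] \<noteq> 0" by (metis coeff_0 zero_neq_one)
qed (simp add: poly_monom)

lemma over_k_0 [simp]: "over_k 0" and over_k_1 [simp]: "over_k 1"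
  by (auto simp: over_k_def one_pCons coeff_pCons split: nat.split)

lemma over_k_pCons: "a \<in> k \<Longrightarrow> over_k f \<Longrightarrow> over_k (pCons a f)"
  by (auto simp: over_k_def coeff_pCons split: nat.split)

lemma over_k_add: "over_k f \<Longrightarrow> over_k g \<Longrightarrow> over_k (f + g)"
  by (auto simp: over_k_def intro: k_add)

lemma over_k_diff: "over_k f \<Longrightarrow> over_k g \<Longrightarrow> over_k (f - g)"
  by (auto simp: over_k_def intro: k_diff)

lemma over_k_mult: "over_k f \<Longrightarrow> over_k g \<Longrightarrow> over_k (f * g)"
  by (auto simp: over_k_def coeff_mult intro!: k_sum k_mult)

lemma over_k_smult: "a \<in> k \<Longrightarrow> over_k f \<Longrightarrow> over_k (smult a f)"
  by (auto simp: over_k_def intro: k_mult)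

lemma over_k_pderiv: "over_k f \<Longrightarrow> over_k (pderiv f)"
proof -
  have "of_nat n \<in> k" for n by (induction n) (auto intro: k_add)
  thus "over_k f \<Longrightarrow> over_k (pderiv f)" by (auto simp: over_k_def coeff_pderiv simp del: of_nat_Suc intro!: k_mult)
qed

lemma poly_in_k: "over_k f \<Longrightarrow> x \<in> k \<Longrightarrow> poly f x \<in> k"
  by (auto simp: over_k_def poly_altdef intro!: k_sum k_mult k_power)

lemma over_k_pcompose: "over_k f \<Longrightarrow> over_k g \<Longrightarrow> over_k (pcompose f g)"
  unfolding over_k_def using coeff_pcompose_semiring_closed[of k f g] by (simp add: k_add k_mult)

text \<open>Splitting into linear factors expresses the coefficients through the roots and the
  leading coefficient.\<close>

lemma over_k_if_roots:
  assumes "\<And>x. poly f x = 0 \<Longrightarrow> x \<in> k" "lead_coeff f \<in> k" "f \<noteq> 0"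
  shows "over_k f"
proof -
  obtain A where A: "f = smult (lead_coeff f) (\<Prod>x\<in>#A. [:- x, 1:])"
    using alg_closed_imp_factorization[OF assms(3)] by auto
  have "x \<in> k" if "x \<in># A" for x
  proof (rule assms(1))
    have "poly (\<Prod>x\<in>#A. [:- x, 1:]) x = 0"
      using that by (auto simp: poly_prod_mset)
    thus "poly f x = 0" by (subst A) simp
  qed
  hence "over_k (\<Prod>x\<in>#A. [:- x, 1:])"
    by (induction A) (auto intro!: over_k_mult over_k_pCons k_minus simp del: mult_pCons_left)
  thus ?thesis using assms(2) by (subst A) (rule over_k_smult)
qed

text \<open>Euclid's argument: for finite \<open>k\<close>, one plus the product of all
  \<open>z - a\<close> would have a root, which lies in \<open>k\<close> although the polynomial is
  1 on \<open>k\<close>.\<close>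

lemma infinite_k: "infinite k"
proof
  assume fin: "finite k"
  define f where "f = (\<Prod>a\<in>k. [:- a, 1:]) + 1"
  have prod: "over_k (\<Prod>a\<in>A. [:- a, 1:])" "degree (\<Prod>a\<in>A. [:- a, 1:]) = card A" "(\<Prod>a\<in>A. [:- a, 1:]) \<noteq> 0"
    if "finite A" "A \<subseteq> k" for A
    using that by (induction A rule: finite_induct)
      (auto simp: degree_mult_eq simp del: mult_pCons_left intro!: over_k_mult over_k_pCons k_minus)
  have "card k > 0" using fin k_0 by (auto simp: card_gt_0_iff simp del: k_0)
  hence deg: "degree f > 0" unfolding f_def using prod[OF fin] by (subst degree_add_eq_left) auto
  then obtain x where x: "poly f x = 0" using alg_closed_imp_poly_has_root by blast
  have "x \<in> k" by (rule k_root[OF _ _ x]) (use prod[OF fin] deg in \<open>auto simp: f_def intro!: over_k_add\<close>)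
  hence "poly (\<Prod>a\<in>k. [:- a, 1:]) x = 0" using fin by (auto simp: poly_prod)
  thus False using x by (simp add: f_def)
qed

end

section \<open>Rational maps on the projective line\<close>

text \<open>Homogeneous coordinates; \<open>(0, 0)\<close> is sent to the junk value \<open>Infty\<close>.\<close>
definition pt :: "'a::field \<Rightarrow> 'a \<Rightarrow> 'a P1" where
  "pt x y = (if y = 0 then Infty else Fin (x / y))"

text \<open>The degree \<open>d\<close> is a parameter so that numerator and denominator are
  homogenised alike, even if their degrees differ.\<close>

definition homog :: "nat \<Rightarrow> 'a::field poly \<Rightarrow> 'a \<Rightarrow> 'a \<Rightarrow> 'a" where
  "homog d f x y = (\<Sum>i\<le>d. coeff f i * x ^ i * y ^ (d - i))"

text \<open>For \<open>degree f \<le> d\<close> this is \<open>v ^ d\<close> times \<open>f\<close>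
  at \<open>u / v\<close>, as arises from clearing denominators in a composite.\<close>

definition homog_poly :: "nat \<Rightarrow> 'a::field poly \<Rightarrow> 'a poly \<Rightarrow> 'a poly \<Rightarrow> 'a poly" where
  "homog_poly d f u v = (\<Sum>i\<le>d. smult (coeff f i) (u ^ i * v ^ (d - i)))"

definition ev :: "nat \<Rightarrow> 'a::field poly \<Rightarrow> 'a poly \<Rightarrow> 'a P1 \<Rightarrow> 'a P1" where
  "ev d f g x = (case x of Fin z \<Rightarrow> pt (poly f z) (poly g z) | Infty \<Rightarrow> pt (coeff f d) (coeff g d))"

text \<open>The denominator need not be monic, so pairs can be rescaled; a zero denominator gives
  the constant map \<open>Infty\<close>.\<close>

definition lowest_terms :: "nat \<Rightarrow> 'a::field poly \<Rightarrow> 'a poly \<Rightarrow> bool" where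
  "lowest_terms d f g \<longleftrightarrow> coprime f g \<and> max (degree f) (degree g) = d"

definition ratmap :: "nat \<Rightarrow> ('a::field P1 \<Rightarrow> 'a P1) \<Rightarrow> bool" where
  "ratmap d F \<longleftrightarrow> (\<exists>f g. lowest_terms d f g \<and> F = ev d f g)"

lemma pt_simps [simp]: "pt x 0 = Infty" "y \<noteq> 0 \<Longrightarrow> pt x y = Fin (x / y)" "pt x 1 = Fin x"
  by (simp_all add: pt_def)

lemma pt_cases:
  obtains x y where "p = pt x y" "x \<noteq> 0 \<or> y \<noteq> 0"
proof (cases p)
  case (Fin z) thus ?thesis using that[of z 1] by simp
next
  case Infty thus ?thesis using that[of 1 0] by simp
qed

lemma pt_eq_iff:
  assumes "x \<noteq> 0 \<or> y \<noteq> 0" "a \<noteq> 0 \<or> b \<noteq> 0"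
  shows "pt x y = pt a b \<longleftrightarrow> b * x = a * y"
  using assms by (auto simp: pt_def field_simps)

lemma pt_scale: "c \<noteq> 0 \<Longrightarrow> pt (c * x) (c * y) = pt x y"
  by (simp add: pt_def)

lemma homog_nonzero: assumes "y \<noteq> 0" "degree f \<le> d" shows "homog d f x y = y ^ d * poly f (x / y)"
proof -
  have "poly f (x / y) = (\<Sum>i\<le>d. coeff f i * (x / y) ^ i)"
    unfolding poly_altdef using assms(2)
    by (intro sum.mono_neutral_left) (auto simp: coeff_eq_0)
  thus ?thesis using assms(1) unfolding homog_def
    by (auto simp: sum_distrib_left power_divide field_simps power_diff intro!: sum.cong)
qed

lemma homog_y0: "homog d f x 0 = coeff f d * x ^ d"
proof -
  have "homog d f x 0 = (\<Sum>i\<in>{d}. coeff f i * x ^ i * 0 ^ (d - i))"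
    unfolding homog_def by (intro sum.mono_neutral_right) auto
  thus ?thesis by simp
qed

lemma homog_y1: "degree f \<le> d \<Longrightarrow> homog d f x 1 = poly f x"
  by (simp add: homog_nonzero)

lemma ev_pt:
  assumes "x \<noteq> 0 \<or> y \<noteq> 0" "degree f \<le> d" "degree g \<le> d"
  shows "ev d f g (pt x y) = pt (homog d f x y) (homog d g x y)"
proof (cases "y = 0")
  case True
  hence "x \<noteq> 0" using assms by simp
  thus ?thesis using True pt_scale[of "x ^ d" "coeff f d" "coeff g d"]
    by (simp add: ev_def homog_y0 mult.commute)
next
  case False
  thus ?thesis using assms pt_scale[of "y ^ d"] by (simp add: ev_def homog_nonzero)
qed

lemma ev_Fin: "ev d f g (Fin z) = pt (poly f z) (poly g z)"
  and ev_Infty: "ev d f g Infty = pt (coeff f d) (coeff g d)"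
  by (simp_all add: ev_def)

lemma lowest_terms_degree: "lowest_terms d f g \<Longrightarrow> degree f \<le> d" "lowest_terms d f g \<Longrightarrow> degree g \<le> d"
  by (auto simp: lowest_terms_def)

lemma lowest_terms_poly: "lowest_terms d f g \<Longrightarrow> poly f z \<noteq> 0 \<or> poly g z \<noteq> 0"
  by (auto simp: lowest_terms_def dest: coprime_poly_0[of f g z])

lemma lowest_terms_coeff: 
  assumes "lowest_terms d f g" shows "coeff f d \<noteq> 0 \<or> coeff g d \<noteq> 0"
proof -
  have "f \<noteq> 0 \<or> g \<noteq> 0" using assms by (auto simp: lowest_terms_def)
  thus ?thesis using assms unfolding lowest_terms_def max_def
    by (metis coeff_eq_0 degree_0 leading_coeff_0_iff linorder_not_le nle_le le_zero_eq)
qed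

text \<open>Coprimality excludes common zeros at finite points, and attaining the degree
  \<open>d\<close> excludes one at infinity.\<close>

lemma lowest_terms_homog:
  assumes "lowest_terms d f g" "x \<noteq> 0 \<or> y \<noteq> 0"
  shows "homog d f x y \<noteq> 0 \<or> homog d g x y \<noteq> 0"
  using assms lowest_terms_degree[OF assms(1)] lowest_terms_poly[OF assms(1), of "x / y"]
    lowest_terms_coeff[OF assms(1)]
  by (cases "y = 0") (auto simp: homog_nonzero homog_y0)

lemma coprime_if_no_common_root:
  fixes f g :: "'a::alg_closed_field poly"
  assumes "\<And>z. poly f z \<noteq> 0 \<or> poly g z \<noteq> 0"
  shows "coprime f g"
proof (rule coprimeI)
  fix c assume c: "c dvd f" "c dvd g"
  have no_root: "poly c z \<noteq> 0" for z
    using c assms[of z] by (auto elim!: dvdE)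
  hence "degree c = 0" using alg_closed_imp_poly_has_root by blast
  moreover have "c \<noteq> 0" using no_root by auto
  ultimately show "is_unit c" by (simp add: is_unit_iff_degree)
qed

lemma lowest_termsI:
  fixes f g :: "'a::alg_closed_field poly"
  assumes "\<And>z. poly f z \<noteq> 0 \<or> poly g z \<noteq> 0" "degree f \<le> d" "degree g \<le> d"
    "coeff f d \<noteq> 0 \<or> coeff g d \<noteq> 0"
  shows "lowest_terms d f g"
  using coprime_if_no_common_root[OF assms(1)] assms(2-) le_degree[of f d] le_degree[of g d]
  unfolding lowest_terms_def by (auto simp: max_def)

section \<open>Composition of rational maps\<close>

lemma poly_homog_poly: "poly (homog_poly d f u v) z = homog d f (poly u z) (poly v z)"
  by (simp add: homog_poly_def homog_def poly_sum mult.assoc)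

lemma coeff_mult_top: "degree p \<le> m \<Longrightarrow> degree q \<le> n \<Longrightarrow> coeff (p * q) (m + n) = coeff p m * coeff q n"
  for p q :: "'a::field poly"
proof -
  assume *: "degree p \<le> m" "degree q \<le> n"
  have "coeff (p * q) (m + n) = (\<Sum>i\<in>{m}. coeff p i * coeff q (m + n - i))"
    unfolding coeff_mult using *
    by (intro sum.mono_neutral_right) (auto simp: coeff_eq_0 not_le nat_neq_iff)
  thus ?thesis by simp
qed

lemma coeff_power_top: "degree p \<le> m \<Longrightarrow> coeff (p ^ n) (m * n) = coeff p m ^ n"
  for p :: "'a::field poly"
proof (induction n)
  case (Suc n)
  have "degree (p ^ n) \<le> m * n" using Suc.prems degree_power_le[of p n] by (meson le_trans mult_le_mono1)
  thus ?case using Suc coeff_mult_top[of p m "p ^ n" "m * n"] by simp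
qed simp

lemma degree_homog_poly_term:
  fixes u v :: "'a::field poly"
  assumes "degree u \<le> e" "degree v \<le> e" "i \<le> d"
  shows "degree (u ^ i * v ^ (d - i)) \<le> e * d" "coeff (u ^ i * v ^ (d - i)) (e * d) = coeff u e ^ i * coeff v e ^ (d - i)"
proof -
  have *: "degree (u ^ i) \<le> e * i" "degree (v ^ (d - i)) \<le> e * (d - i)"
    using assms degree_power_le[of u i] degree_power_le[of v "d - i"] by (meson le_trans mult_le_mono1)+
  have ed: "e * d = e * i + e * (d - i)" using assms(3) by (simp flip: add_mult_distrib2)
  show "degree (u ^ i * v ^ (d - i)) \<le> e * d"
    using * ed degree_mult_le[of "u ^ i" "v ^ (d - i)"] by linarith
  show "coeff (u ^ i * v ^ (d - i)) (e * d) = coeff u e ^ i * coeff v e ^ (d - i)"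
    unfolding ed by (simp only: coeff_mult_top[OF *] coeff_power_top[OF assms(1)] coeff_power_top[OF assms(2)])
qed

lemma degree_homog_poly:
  assumes "degree u \<le> e" "degree v \<le> e"
  shows "degree (homog_poly d f u v) \<le> d * e"
  unfolding homog_poly_def
  by (intro degree_sum_le order.trans[OF degree_smult_le])
     (use degree_homog_poly_term[OF assms] in \<open>auto simp: mult.commute\<close>)

lemma coeff_homog_poly:
  assumes "degree u \<le> e" "degree v \<le> e"
  shows "coeff (homog_poly d f u v) (d * e) = homog d f (coeff u e) (coeff v e)"
  unfolding homog_poly_def homog_def coeff_sum
  by (intro sum.cong) (use degree_homog_poly_term[OF assms] in \<open>auto simp: mult.commute mult.left_commute\<close>)

text \<open>The inner pair never vanishes simultaneously, nor do the outer forms on nonzero vectors,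
  so the composite pair has no common zero, finite or infinite.\<close>

lemma lowest_terms_comp:
  fixes f g u v :: "'a::alg_closed_field poly"
  assumes "lowest_terms d f g" "lowest_terms e u v"
  shows "lowest_terms (d * e) (homog_poly d f u v) (homog_poly d g u v)"
  using lowest_terms_degree[OF assms(2)] lowest_terms_homog[OF assms(1)]
    lowest_terms_poly[OF assms(2)] lowest_terms_coeff[OF assms(2)]
  by (intro lowest_termsI) (simp_all add: degree_homog_poly poly_homog_poly coeff_homog_poly)

lemma ev_comp:
  fixes f g u v :: "'a::alg_closed_field poly"
  assumes "lowest_terms d f g" "lowest_terms e u v"
  shows "ev (d * e) (homog_poly d f u v) (homog_poly d g u v) = ev d f g \<circ> ev e u v"
proof
  fix x
  note deg = lowest_terms_degree[OF assms(1)] lowest_terms_degree[OF assms(2)]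
  show "ev (d * e) (homog_poly d f u v) (homog_poly d g u v) x = (ev d f g \<circ> ev e u v) x"
  proof (cases x)
    case (Fin z)
    thus ?thesis using ev_pt[OF lowest_terms_poly[OF assms(2)] deg(1,2)]
      by (simp add: ev_Fin poly_homog_poly)
  next
    case Infty
    thus ?thesis using ev_pt[OF lowest_terms_coeff[OF assms(2)] deg(1,2)] deg
      by (simp add: ev_Infty coeff_homog_poly)
  qed
qed

lemma ratmap_comp:
  fixes F :: "'a::alg_closed_field P1 \<Rightarrow> 'a P1"
  shows "ratmap d F \<Longrightarrow> ratmap e G \<Longrightarrow> ratmap (d * e) (F \<circ> G)"
  unfolding ratmap_def using lowest_terms_comp ev_comp by metis

lemma ratmap_comp_left: "ratmap 1 (\<sigma> :: 'a::alg_closed_field P1 \<Rightarrow> _) \<Longrightarrow> ratmap d F \<Longrightarrow> ratmap d (\<sigma> \<circ> F)"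
  using ratmap_comp[of 1 \<sigma> d F] by simp

lemma ratmap_comp_right: "ratmap d F \<Longrightarrow> ratmap 1 (\<sigma> :: 'a::alg_closed_field P1 \<Rightarrow> _) \<Longrightarrow> ratmap d (F \<circ> \<sigma>)"
  using ratmap_comp[of d F 1 \<sigma>] by simp

section \<open>Moebius maps\<close>

lemma lowest_terms_linear:
  assumes "a * d - b * c \<noteq> (0::'a::alg_closed_field)"
  shows "lowest_terms 1 [:b, a:] [:d, c:]"
proof (rule lowest_termsI)
  fix z show "poly [:b, a:] z \<noteq> 0 \<or> poly [:d, c:] z \<noteq> 0"
  proof (rule ccontr)
    assume "\<not> ?thesis"
    hence "b + z * a = 0" "d + z * c = 0" by auto
    hence "b = - (z * a)" "d = - (z * c)" by (simp_all add: eq_neg_iff_add_eq_0)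
    thus False using assms by (simp add: algebra_simps)
  qed
qed (use assms in auto)

lemma ratmap_1E:
  assumes "ratmap 1 \<sigma>"
  obtains a b c d where "a * d - b * c \<noteq> (0::'a::alg_closed_field)" "\<sigma> = ev 1 [:b, a:] [:d, c:]"
proof -
  obtain f g where fg: "lowest_terms 1 f g" "\<sigma> = ev 1 f g" using assms by (auto simp: ratmap_def)
  have lin: "p = [:coeff p 0, coeff p 1:]" if "degree p \<le> 1" for p :: "'a poly"
    using that by (intro poly_eqI) (auto simp: coeff_pCons coeff_eq_0 split: nat.split)
  define a b c d where "a = coeff f 1" and "b = coeff f 0" and "c = coeff g 1" and "d = coeff g 0"
  have f: "f = [:b, a:]" and g: "g = [:d, c:]"
    unfolding a_def b_def c_def d_def using lin lowest_terms_degree[OF fg(1)] by auto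
  have "a * d - b * c \<noteq> 0"
  proof
    assume det: "a * d - b * c = 0"
    have "a \<noteq> 0 \<or> c \<noteq> 0" using lowest_terms_coeff[OF fg(1)] by (simp add: a_def c_def)
    thus False
    proof
      assume "a \<noteq> 0"
      thus False using lowest_terms_poly[OF fg(1), of "- b / a"] det by (simp add: f g field_simps)
    next
      assume "c \<noteq> 0"
      thus False using lowest_terms_poly[OF fg(1), of "- d / c"] det by (simp add: f g field_simps)
    qed
  qed
  thus ?thesis using that fg f g by blast
qed

lemma ratmap_1I: "a * d - b * c \<noteq> (0::'a::alg_closed_field) \<Longrightarrow> ratmap 1 (ev 1 [:b, a:] [:d, c:])"
  using lowest_terms_linear ratmap_def by blast

text \<open>The inner map comes from the adjugate matrix, so the composite multiplies homogeneous
  coordinates by the determinant.\<close>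

lemma ev_linear_inverse:
  assumes "a * d - b * c \<noteq> (0::'a::alg_closed_field)"
  shows "ev 1 [:b, a:] [:d, c:] (ev 1 [:- b, d:] [:a, - c:] x) = x"
proof -
  have det2: "d * a - (- b) * (- c) \<noteq> 0" using assms by (simp add: mult.commute)
  define D where "D = a * d - b * c"
  obtain u v where x: "x = pt u v" and uv: "u \<noteq> 0 \<or> v \<noteq> 0" by (rule pt_cases)
  have h: "homog 1 [:q, p:] s t = p * s + q * t" for p q s t :: 'a
    by (simp add: homog_def)
  have ev: "ev 1 [:q, p:] [:q', p':] (pt s t) = pt (p * s + q * t) (p' * s + q' * t)"
    if "s \<noteq> 0 \<or> t \<noteq> 0" for p q p' q' s t :: 'a
    using ev_pt[OF that, of "[:q, p:]" 1 "[:q', p':]"] unfolding h by auto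
  have nz: "d * u - b * v \<noteq> 0 \<or> a * v - c * u \<noteq> 0"
    using lowest_terms_homog[OF lowest_terms_linear[OF det2] uv] unfolding h by auto
  have "ev 1 [:b, a:] [:d, c:] (ev 1 [:- b, d:] [:a, - c:] x) =
      pt (a * (d * u - b * v) + b * (a * v - c * u)) (c * (d * u - b * v) + d * (a * v - c * u))"
    unfolding x using ev[OF uv, of "- b" d a "- c"] ev[OF nz, of b a d c] by (simp add: algebra_simps)
  also have "\<dots> = pt (D * u) (D * v)" by (simp add: D_def algebra_simps)
  also have "\<dots> = x" unfolding x by (rule pt_scale) (use assms in \<open>simp add: D_def\<close>)
  finally show ?thesis .
qed

lemma ratmap_1_inverse:
  assumes "ratmap 1 (\<sigma> :: 'a::alg_closed_field P1 \<Rightarrow> 'a P1)"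
  obtains \<tau> where "ratmap 1 \<tau>" "\<sigma> \<circ> \<tau> = id" "\<tau> \<circ> \<sigma> = id"
proof -
  obtain a b c d where det: "a * d - b * c \<noteq> 0" and \<sigma>: "\<sigma> = ev 1 [:b, a:] [:d, c:]"
    using assms by (rule ratmap_1E)
  define \<tau> where "\<tau> = ev 1 [:- b, d:] [:a, - c:]"
  have det2: "d * a - (- b) * (- c) \<noteq> 0" using det by (simp add: mult.commute)
  show ?thesis
  proof
    show "ratmap 1 \<tau>" unfolding \<tau>_def by (rule ratmap_1I) (use det2 in simp)
    show "\<sigma> \<circ> \<tau> = id" using ev_linear_inverse[OF det] by (auto simp: \<sigma> \<tau>_def)
    show "\<tau> \<circ> \<sigma> = id" using ev_linear_inverse[of d a "- b" "- c"] det2 by (auto simp: \<sigma> \<tau>_def)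
  qed
qed

lemma ratmap_1_bij: "ratmap 1 (\<sigma> :: 'a::alg_closed_field P1 \<Rightarrow> 'a P1) \<Longrightarrow> bij \<sigma>"
proof -
  assume "ratmap 1 \<sigma>"
  then obtain \<tau> where "\<sigma> \<circ> \<tau> = id" "\<tau> \<circ> \<sigma> = id" by (rule ratmap_1_inverse)
  thus "bij \<sigma>" using o_bij by blast
qed

lemma ratmap_id: "ratmap 1 (id :: 'a::alg_closed_field P1 \<Rightarrow> 'a P1)"
proof -
  have "ev 1 [:0, 1:] [:1, 0:] = (id :: 'a P1 \<Rightarrow> 'a P1)"
    by (auto simp: ev_def split: P1.split)
  thus ?thesis using ratmap_1I[of 1 1 0 "0::'a"] by simp
qed

definition affine :: "'a::field \<Rightarrow> 'a \<Rightarrow> 'a P1 \<Rightarrow> 'a P1" where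
  "affine a b x = (case x of Fin z \<Rightarrow> Fin (a * z + b) | Infty \<Rightarrow> Infty)"

lemma affine_simps [simp]: "affine a b (Fin z) = Fin (a * z + b)" "affine a b Infty = Infty"
  by (simp_all add: affine_def)

lemma ratmap_affine: "a \<noteq> 0 \<Longrightarrow> ratmap 1 (affine a (b::'a::alg_closed_field))"
proof -
  assume "a \<noteq> 0"
  have "ev 1 [:b, a:] [:1, 0:] = affine a b"
    by (auto simp: ev_def affine_def algebra_simps split: P1.split)
  thus ?thesis using ratmap_1I[of a 1 b 0] \<open>a \<noteq> 0\<close> by simp
qed

lemma exists_ratmap_to_Infty:
  obtains \<sigma> where "ratmap 1 \<sigma>" "\<sigma> (x :: 'a::alg_closed_field P1) = Infty"
proof (cases x)
  case (Fin z)
  have "ratmap 1 (ev 1 [:1, 0:] [:- z, 1:])" by (rule ratmap_1I) simp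
  moreover have "ev 1 [:1, 0:] [:- z, 1:] x = Infty" by (simp add: ev_def Fin)
  ultimately show ?thesis using that by blast
next
  case Infty
  thus ?thesis using that[OF ratmap_id] by simp
qed

lemma exists_ratmap_three:
  assumes "x \<noteq> y" "x \<noteq> z" "y \<noteq> (z :: 'a::alg_closed_field P1)"
  obtains \<sigma> where "ratmap 1 \<sigma>" "\<sigma> x = Infty" "\<sigma> y = Fin 0" "\<sigma> z = Fin 1"
proof -
  obtain \<tau> where \<tau>: "ratmap 1 \<tau>" "\<tau> x = Infty" by (rule exists_ratmap_to_Infty)
  have inj: "inj \<tau>" using ratmap_1_bij[OF \<tau>(1)] bij_is_inj by blast
  have "\<tau> y \<noteq> Infty" "\<tau> z \<noteq> Infty" using inj \<tau>(2) assms injD by metis+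
  then obtain u v where uv: "\<tau> y = Fin u" "\<tau> z = Fin v" by (meson P1.exhaust)
  have "u \<noteq> v" using inj uv assms injD by metis
  define \<rho> where "\<rho> = affine (1 / (v - u)) (- u / (v - u)) \<circ> \<tau>"
  show ?thesis
  proof
    show "ratmap 1 \<rho>" unfolding \<rho>_def
      by (intro ratmap_comp_left ratmap_affine \<tau>) (use \<open>u \<noteq> v\<close> in simp)
    show "\<rho> x = Infty" by (simp add: \<rho>_def \<tau>)
    show "\<rho> y = Fin 0" by (simp add: \<rho>_def uv)
    show "\<rho> z = Fin 1" using \<open>u \<noteq> v\<close> by (simp add: \<rho>_def uv flip: diff_divide_distrib)
  qed
qed

lemma ratmap_1_fix_Infty:
  assumes "ratmap 1 (\<sigma> :: 'a::alg_closed_field P1 \<Rightarrow> 'a P1)" "\<sigma> Infty = Infty"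
  obtains a b where "a \<noteq> 0" "\<sigma> = affine a b"
proof -
  obtain a b c d where det: "a * d - b * c \<noteq> 0" and \<sigma>: "\<sigma> = ev 1 [:b, a:] [:d, c:]"
    using assms(1) by (rule ratmap_1E)
  have c: "c = 0" using assms(2) by (cases "c = 0") (auto simp: \<sigma> ev_def)
  hence "a \<noteq> 0" "d \<noteq> 0" using det by auto
  moreover have "\<sigma> = affine (a / d) (b / d)" using \<open>d \<noteq> 0\<close>
    by (auto simp: \<sigma> c ev_def affine_def fun_eq_iff field_simps split: P1.split)
  ultimately show ?thesis using that[of "a / d" "b / d"] by simp
qed

section \<open>Structures over the algebraic closure of the prime field\<close>

text \<open>The combination cuts out the fibre over \<open>pt a b\<close>. A linear relation between
  the coprime \<open>f\<close> and \<open>g\<close> would make both constant, contrary to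
  \<open>d > 0\<close>.\<close>

lemma lowest_terms_combination_nonzero:
  assumes "lowest_terms d f g" "d > 0" "a \<noteq> 0 \<or> b \<noteq> (0::'a::field)"
  shows "smult b f - smult a g \<noteq> 0"
proof
  assume "smult b f - smult a g = 0"
  hence eq: "smult b f = smult a g" by simp
  have cop: "coprime f g" using assms(1) by (simp add: lowest_terms_def)
  have "degree f = 0 \<and> degree g = 0"
  proof (cases "b = 0")
    case True
    hence "g = 0" using eq assms(3) by simp
    thus ?thesis using cop by (simp add: is_unit_iff_degree)
  next
    case False
    have "smult (inverse b) (smult b f) = smult (inverse b) (smult a g)" by (simp only: eq)
    hence f: "f = smult (a / b) g" using False by (simp add: field_simps)
    hence "g dvd f" by (simp add: dvd_smult)
    hence "is_unit g" using cop by (simp add: coprime_absorb_right)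
    thus ?thesis using f by (auto simp: is_unit_iff_degree)
  qed
  thus False using assms(1,2) by (simp add: lowest_terms_def)
qed

text \<open>In the homogeneous equation \<open>b * f = a * g\<close>, infinity is a solution exactly
  when the coefficient at \<open>z ^ d\<close> vanishes.\<close>

lemma ev_fibre:
  assumes "lowest_terms d f g" "a \<noteq> 0 \<or> b \<noteq> (0::'a::field)"
  defines "h \<equiv> smult b f - smult a g"
  shows "ev d f g -` {pt a b} = Fin ` {z. poly h z = 0} \<union> (if coeff h d = 0 then {Infty} else {})"
proof (rule Set.set_eqI)
  fix x show "x \<in> ev d f g -` {pt a b} \<longleftrightarrow> x \<in> Fin ` {z. poly h z = 0} \<union> (if coeff h d = 0 then {Infty} else {})"
  proof (cases x)
    case (Fin z)
    thus ?thesis using pt_eq_iff[OF lowest_terms_poly[OF assms(1)] assms(2)]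
      by (auto simp: ev_Fin h_def)
  next
    case Infty
    thus ?thesis using pt_eq_iff[OF lowest_terms_coeff[OF assms(1)] assms(2)]
      by (auto simp: ev_Infty h_def)
  qed
qed

lemma degree_combination: "lowest_terms d f g \<Longrightarrow> degree (smult b f - smult a g) \<le> d"
  using lowest_terms_degree[of d f g] by (intro degree_diff_le order.trans[OF degree_smult_le]) auto

lemma card_Fin_image [simp]: "card (Fin ` A) = card A"
  by (rule card_image) (auto intro: inj_onI)

lemma finite_Fin_image [simp]: "finite (Fin ` A) \<longleftrightarrow> finite A"
  by (simp add: finite_image_iff inj_on_def)

lemma ratmap_finite_fibre:
  assumes "ratmap d F" "d > 0" shows "finite (F -` {y :: 'a::field P1})"
proof -
  obtain f g where fg: "lowest_terms d f g" "F = ev d f g" using assms by (auto simp: ratmap_def)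
  obtain a b where y: "y = pt a b" and ab: "a \<noteq> 0 \<or> b \<noteq> 0" by (rule pt_cases)
  show ?thesis unfolding fg y ev_fibre[OF fg(1) ab]
    using poly_roots_finite[OF lowest_terms_combination_nonzero[OF fg(1) assms(2) ab]] by auto
qed

lemma ratmap_surj:
  assumes "ratmap d F" "d > 0" shows "surj (F :: 'a::alg_closed_field P1 \<Rightarrow> 'a P1)"
proof -
  obtain f g where fg: "lowest_terms d f g" "F = ev d f g" using assms by (auto simp: ratmap_def)
  have "\<exists>x. F x = y" for y
  proof -
    obtain a b where y: "y = pt a b" and ab: "a \<noteq> 0 \<or> b \<noteq> 0" by (rule pt_cases)
    define h where "h = smult b f - smult a g"
    have fib: "F -` {y} = Fin ` {z. poly h z = 0} \<union> (if coeff h d = 0 then {Infty} else {})"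
      unfolding fg y h_def by (rule ev_fibre[OF fg(1) ab])
    show ?thesis
    proof (cases "degree h = 0")
      case True
      hence "coeff h d = 0" using assms(2) by (simp add: coeff_eq_0)
      thus ?thesis using fib by auto
    next
      case False
      then obtain z where "poly h z = 0" using alg_closed_imp_poly_has_root by blast
      thus ?thesis using fib by auto
    qed
  qed
  thus ?thesis unfolding surj_def by metis
qed

lemma ev_smult: "c \<noteq> 0 \<Longrightarrow> ev d (smult c f) (smult c g) = ev d f g"
  by (auto simp: ev_def pt_scale split: P1.split)

lemma lowest_terms_smult:
  fixes f g :: "'a::alg_closed_field poly"
  assumes "c \<noteq> 0" "lowest_terms d f g" shows "lowest_terms d (smult c f) (smult c g)"
  using assms lowest_terms_poly[OF assms(2)] lowest_terms_degree[OF assms(2)] lowest_terms_coeff[OF assms(2)]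
  by (intro lowest_termsI) auto

context alg_closed_char_p
begin

section \<open>Projective lines over the algebraic constants\<close>

definition Pk :: "'a P1 set" where "Pk = Fin ` k \<union> {Infty}"

text \<open>As Moebius maps are bijective, preimages of \<open>Pk\<close> are the same sets as its
  images; the preimage form suits pulling back along maps.\<close>

definition k_structure :: "'a P1 set \<Rightarrow> bool" where
  "k_structure W \<longleftrightarrow> (\<exists>\<sigma>. ratmap 1 \<sigma> \<and> W = \<sigma> -` Pk)"

lemma Pk_simps [simp]: "Fin z \<in> Pk \<longleftrightarrow> z \<in> k" "Infty \<in> Pk"
  by (auto simp: Pk_def)

lemma pt_in_Pk: "a \<in> k \<Longrightarrow> b \<in> k \<Longrightarrow> pt a b \<in> Pk"
  by (simp add: pt_def k_divide)

lemma Pk_cases: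
  assumes "y \<in> Pk" obtains a b where "y = pt a b" "a \<in> k" "b \<in> k" "a \<noteq> 0 \<or> b \<noteq> 0"
proof (cases y)
  case (Fin z) thus ?thesis using that[of z 1] assms by simp
next
  case Infty thus ?thesis using that[of 1 0] by simp
qed

text \<open>The fibre over a point of \<open>Pk\<close> is cut out by a nonzero polynomial over
  \<open>k\<close>, whose roots lie in \<open>k\<close>.\<close>

lemma ev_vimage_Pk:
  assumes "lowest_terms d f g" "d > 0" "over_k f" "over_k g"
  shows "ev d f g -` Pk = Pk"
proof (intro equalityI subsetI)
  fix x assume "x \<in> ev d f g -` Pk"
  hence "ev d f g x \<in> Pk" by simp
  then obtain a b where ab: "ev d f g x = pt a b" "a \<in> k" "b \<in> k" "a \<noteq> 0 \<or> b \<noteq> 0"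
    by (rule Pk_cases)
  hence "x \<in> ev d f g -` {pt a b}" by simp
  hence x: "x \<in> Fin ` {z. poly (smult b f - smult a g) z = 0} \<union> {Infty}"
    unfolding ev_fibre[OF assms(1) ab(4)] by (auto split: if_splits)
  have "over_k (smult b f - smult a g)" using assms ab by (intro over_k_diff over_k_smult)
  thus "x \<in> Pk"
    using x k_root[OF _ lowest_terms_combination_nonzero[OF assms(1,2) ab(4)]] by auto
next
  fix x assume "x \<in> Pk"
  thus "x \<in> ev d f g -` Pk" using assms(3,4)
    by (cases x) (auto simp: ev_Fin ev_Infty over_k_def[symmetric] intro!: pt_in_Pk poly_in_k, auto simp: over_k_def)
qed

text \<open>
  The roots of \<open>f\<close> and \<open>g\<close> lie in \<open>k\<close>, so up to constants \<open>f\<close> and \<open>g\<close> are over \<open>k\<close>; the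
  fibre over \<open>1\<close> forces the quotient of these constants to lie in \<open>k\<close>.
\<close>
lemma over_k_if_fibres_in_Pk:
  assumes "ratmap d F" "d > 0" "F -` {Fin 0, Fin 1, Infty} \<subseteq> Pk"
  obtains f g where "lowest_terms d f g" "F = ev d f g" "over_k f" "over_k g"
proof -
  obtain f g where fg: "lowest_terms d f g" "F = ev d f g" using assms by (auto simp: ratmap_def)
  note nz = lowest_terms_combination_nonzero[OF fg(1) assms(2)]
  have f0: "f \<noteq> 0" and g0: "g \<noteq> 0" using nz[of 0 1] nz[of 1 0] by auto
  define \<alpha> \<beta> A B where "\<alpha> = lead_coeff f" and "\<beta> = lead_coeff g"
    and "A = smult (inverse \<alpha>) f" and "B = smult (inverse \<beta>) g"
  have \<alpha>\<beta>: "\<alpha> \<noteq> 0" "\<beta> \<noteq> 0" using f0 g0 by (simp_all add: \<alpha>_def \<beta>_def)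
  have f: "f = smult \<alpha> A" and g: "g = smult \<beta> B" using \<alpha>\<beta> by (simp_all add: A_def B_def)
  have root: "z \<in> k" if "poly f z = 0 \<or> poly g z = 0" for z
  proof -
    have "F (Fin z) \<in> {Fin 0, Fin 1, Infty}"
      using that lowest_terms_poly[OF fg(1), of z] by (auto simp: fg ev_Fin pt_def)
    hence "Fin z \<in> Pk" using assms(3) by blast
    thus ?thesis by simp
  qed
  have A: "over_k A" and B: "over_k B" using root \<alpha>\<beta>
    by (auto intro!: over_k_if_roots simp: A_def B_def \<alpha>_def \<beta>_def)
  have "surj F" by (rule ratmap_surj[OF assms(1,2)])
  then obtain x where x: "F x = Fin 1" unfolding surj_def by metis
  hence xk: "x \<in> Pk" using assms(3) by blast
  have "\<exists>r s. r \<in> k \<and> s \<in> k \<and> \<alpha> * r = \<beta> * s \<and> \<beta> * s \<noteq> 0"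
  proof (cases x)
    case (Fin z)
    have "\<alpha> * poly A z = \<beta> * poly B z" "\<beta> * poly B z \<noteq> 0"
      using x by (auto simp: Fin fg ev_Fin pt_def f g split: if_splits)
    thus ?thesis using poly_in_k[OF A] poly_in_k[OF B] xk Fin by auto
  next
    case Infty
    have "\<alpha> * coeff A d = \<beta> * coeff B d" "\<beta> * coeff B d \<noteq> 0"
      using x by (auto simp: Infty fg ev_Infty pt_def f g split: if_splits)
    thus ?thesis using A B unfolding over_k_def by blast
  qed
  then obtain r s where rs: "r \<in> k" "s \<in> k" "\<alpha> * r = \<beta> * s" "\<beta> * s \<noteq> 0" by blast
  hence "r \<noteq> 0" by auto
  hence "\<alpha> / \<beta> = s / r" using \<alpha>\<beta> rs(3) by (simp add: field_simps)
  hence quot: "\<alpha> / \<beta> \<in> k" using k_divide[OF rs(2,1)] by simp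
  show ?thesis
  proof
    show "lowest_terms d (smult (inverse \<beta>) f) (smult (inverse \<beta>) g)"
      using \<alpha>\<beta> fg(1) by (intro lowest_terms_smult) auto
    show "F = ev d (smult (inverse \<beta>) f) (smult (inverse \<beta>) g)"
      using \<alpha>\<beta> by (simp add: fg ev_smult)
    show "over_k (smult (inverse \<beta>) g)" using B by (simp add: B_def)
    have "smult (inverse \<beta>) f = smult (\<alpha> / \<beta>) A" by (subst f) (simp add: field_simps)
    thus "over_k (smult (inverse \<beta>) f)" using over_k_smult[OF quot A] by simp
  qed
qed

text \<open>Coordinate changes on source and target move both structures to \<open>Pk\<close>. The
  three fibres then force the map to be defined over \<open>k\<close>, so all of \<open>Pk\<close>
  pulls back to \<open>Pk\<close>.\<close>

lemma vimage_k_structure: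
  assumes "ratmap d F" "d > 0" "k_structure W" "ratmap 1 \<tau>"
    "F -` (\<tau> -` {Fin 0, Fin 1, Infty}) \<subseteq> W"
  shows "F -` (\<tau> -` Pk) = W"
proof -
  obtain \<sigma> where \<sigma>: "ratmap 1 \<sigma>" "W = \<sigma> -` Pk" using assms(3) by (auto simp: k_structure_def)
  obtain \<rho> where \<rho>: "ratmap 1 \<rho>" "\<sigma> \<circ> \<rho> = id" "\<rho> \<circ> \<sigma> = id" using \<sigma>(1) by (rule ratmap_1_inverse)
  have \<rho>': "\<sigma> (\<rho> x) = x" "\<rho> (\<sigma> x) = x" for x using \<rho> by (auto simp: fun_eq_iff)
  define G where "G = \<tau> \<circ> F \<circ> \<rho>"
  have G: "ratmap d G" unfolding G_def
    by (intro ratmap_comp_left ratmap_comp_right assms \<rho>)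
  have "G -` {Fin 0, Fin 1, Infty} \<subseteq> Pk"
  proof
    fix x assume "x \<in> G -` {Fin 0, Fin 1, Infty}"
    hence "\<rho> x \<in> W" using assms(5) by (auto simp: G_def)
    thus "x \<in> Pk" by (simp add: \<sigma> \<rho>')
  qed
  then obtain f g where "lowest_terms d f g" "G = ev d f g" "over_k f" "over_k g"
    using over_k_if_fibres_in_Pk[OF G assms(2)] by blast
  hence GPk: "G -` Pk = Pk" using ev_vimage_Pk assms(2) by simp
  show ?thesis
  proof (intro equalityI subsetI)
    fix x assume "x \<in> F -` (\<tau> -` Pk)"
    hence "\<sigma> x \<in> G -` Pk" by (simp add: G_def \<rho>')
    thus "x \<in> W" unfolding GPk \<sigma> by simp
  next
    fix x assume "x \<in> W"
    hence "\<sigma> x \<in> G -` Pk" unfolding GPk \<sigma> by simp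
    thus "x \<in> F -` (\<tau> -` Pk)" by (simp add: G_def \<rho>')
  qed
qed

lemma k_structure_vimage_Pk: "ratmap 1 \<sigma> \<Longrightarrow> k_structure (\<sigma> -` Pk)"
  by (auto simp: k_structure_def)

text \<open>Rigidity of the three fibres, applied to the identity map.\<close>

lemma k_structure_unique:
  assumes "k_structure U" "ratmap 1 \<tau>" "\<tau> -` {Fin 0, Fin 1, Infty} \<subseteq> U"
  shows "U = \<tau> -` Pk"
  using vimage_k_structure[OF ratmap_id _ assms(1,2)] assms(3) by simp

lemma ratmap_three_vimage:
  assumes "ratmap 1 \<tau>" "\<tau> x = Infty" "\<tau> y = Fin 0" "\<tau> z = Fin (1::'a)"
  shows "\<tau> -` {Fin 0, Fin 1, Infty} = {x, y, z}"
proof -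
  have "{Fin 0, Fin 1, Infty} = \<tau> ` {x, y, z}" using assms by auto
  thus ?thesis using ratmap_1_bij[OF assms(1)] by (simp only: inj_vimage_image_eq bij_is_inj)
qed

text \<open>\<open>U\<close> depends on the three points alone: its pullback property holds for
  every \<open>F\<close> and every \<open>W\<close>.\<close>

lemma k_structure_through_three:
  assumes "x \<noteq> y" "x \<noteq> z" "y \<noteq> (z :: 'a P1)"
  obtains U where "k_structure U" "{x, y, z} \<subseteq> U"
    "\<And>d F W. ratmap d F \<Longrightarrow> d > 0 \<Longrightarrow> k_structure W \<Longrightarrow> F -` {x, y, z} \<subseteq> W \<Longrightarrow> F -` U = W"
proof -
  obtain \<tau> where \<tau>: "ratmap 1 \<tau>" "\<tau> x = Infty" "\<tau> y = Fin 0" "\<tau> z = Fin 1"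
    using exists_ratmap_three[OF assms] by blast
  show ?thesis
  proof
    show "k_structure (\<tau> -` Pk)" by (rule k_structure_vimage_Pk[OF \<tau>(1)])
    show "{x, y, z} \<subseteq> \<tau> -` Pk" using \<tau> by simp
    show "F -` (\<tau> -` Pk) = W" if "ratmap d F" "d > 0" "k_structure W" "F -` {x, y, z} \<subseteq> W" for d F W
      using vimage_k_structure[OF that(1-3) \<tau>(1)] that(4) ratmap_three_vimage[OF \<tau>] by simp
  qed
qed

lemma k_structure_eq:
  assumes "k_structure U" "k_structure W" "x \<noteq> y" "x \<noteq> z" "y \<noteq> z" "{x, y, z} \<subseteq> U" "{x, y, z} \<subseteq> W"
  shows "U = W"
proof -
  obtain \<tau> where \<tau>: "ratmap 1 \<tau>" "\<tau> x = Infty" "\<tau> y = Fin 0" "\<tau> z = Fin 1"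
    using exists_ratmap_three[OF assms(3-5)] by blast
  show ?thesis
    using k_structure_unique[OF assms(1) \<tau>(1)] k_structure_unique[OF assms(2) \<tau>(1)]
      ratmap_three_vimage[OF \<tau>] assms(6,7) by simp
qed

text \<open>In coordinates in which \<open>W\<close> is \<open>Pk\<close>, such a map of positive
  degree is given by polynomials over \<open>k\<close>: this is isotriviality in geometric
  form.\<close>

definition k_invariant :: "('a P1 \<Rightarrow> 'a P1) \<Rightarrow> bool" where
  "k_invariant F \<longleftrightarrow> (\<exists>W. k_structure W \<and> F -` W = W)"

text \<open>By injectivity each of the three points is its own fibre, so the structure through them
  pulls back to itself.\<close>

lemma k_invariant_if_three_fixed:
  assumes "ratmap d F" "d > 0" "inj F" "x \<noteq> y" "x \<noteq> z" "y \<noteq> (z :: 'a P1)" "F x = x" "F y = y" "F z = z"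
  shows "k_invariant F"
proof -
  obtain U where U: "k_structure U" "{x, y, z} \<subseteq> U"
    "\<And>d F W. ratmap d F \<Longrightarrow> d > 0 \<Longrightarrow> k_structure W \<Longrightarrow> F -` {x, y, z} \<subseteq> W \<Longrightarrow> F -` U = W"
    using k_structure_through_three[OF assms(4-6)] by blast
  have "F ` {x, y, z} = {x, y, z}" using assms(7-) by simp
  hence "F -` {x, y, z} = {x, y, z}" using inj_vimage_image_eq[OF assms(3)] by metis
  hence "F -` U = U" using U assms by simp
  thus ?thesis using U(1) k_invariant_def by blast
qed

lemma k_structure_vimage_mobius:
  assumes "ratmap 1 \<sigma>" "k_structure W" shows "k_structure (\<sigma> -` W)"
proof -
  obtain \<tau> where "ratmap 1 \<tau>" "W = \<tau> -` Pk" using assms by (auto simp: k_structure_def)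
  thus ?thesis using ratmap_comp_left[OF _ assms(1), of \<tau>] unfolding k_structure_def
    by (intro exI[of _ "\<tau> \<circ> \<sigma>"]) auto
qed

lemma k_invariant_conj:
  assumes "ratmap 1 \<sigma>" "\<sigma> \<circ> \<rho> = id" "\<rho> \<circ> \<sigma> = id" "k_invariant (\<sigma> \<circ> F \<circ> \<rho>)"
  shows "k_invariant F"
proof -
  obtain W where W: "k_structure W" "(\<sigma> \<circ> F \<circ> \<rho>) -` W = W" using assms(4) by (auto simp: k_invariant_def)
  have \<rho>\<sigma>: "\<rho> (\<sigma> x) = x" for x using assms(3) by (simp add: fun_eq_iff)
  have "F -` (\<sigma> -` W) = \<sigma> -` ((\<sigma> \<circ> F \<circ> \<rho>) -` W)" by (auto simp: \<rho>\<sigma>)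
  hence "F -` (\<sigma> -` W) = \<sigma> -` W" by (simp only: W)
  thus ?thesis using k_structure_vimage_mobius[OF assms(1) W(1)] k_invariant_def by blast
qed

end

section \<open>Fibres and branch points\<close>

text \<open>The numerator of the derivative of \<open>f / g\<close>; for coprime \<open>f\<close>
  and \<open>g\<close> its zeros are the finite ramification points.\<close>

definition wronskian :: "'a::field poly \<Rightarrow> 'a poly \<Rightarrow> 'a poly" where
  "wronskian f g = pderiv f * g - f * pderiv g"

text \<open>The induction cancels one linear factor of \<open>u\<close> at a time. In degree 0 the
  case \<open>u = 0\<close> remains, where \<open>v\<close> has no root and is a nonzero
  constant.\<close>

lemma dvd_mult_if_no_common_root:
  fixes u v w :: "'a::alg_closed_field poly"
  assumes "u dvd w * v" "\<And>z. poly u z \<noteq> 0 \<or> poly v z \<noteq> 0"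
  shows "u dvd w"
  using assms
proof (induction "degree u" arbitrary: u w)
  case 0
  show ?case
  proof (cases "u = 0")
    case True
    hence "degree v = 0" using "0.prems"(2) alg_closed_imp_poly_has_root[of v] by fastforce
    hence "v \<noteq> 0" using "0.prems"(2)[of 0] True by auto
    thus ?thesis using "0.prems"(1) True by simp
  next
    case False
    thus ?thesis using "0.hyps" by (simp add: unit_imp_dvd is_unit_iff_degree)
  qed
next
  case (Suc n)
  obtain z where z: "poly u z = 0" using alg_closed_imp_poly_has_root[of u] Suc by auto
  then obtain u' where u': "u = [:- z, 1:] * u'" by (auto simp: poly_eq_0_iff_dvd)
  have "u \<noteq> 0" using Suc by auto
  hence deg: "degree u = Suc (degree u')" unfolding u' by (subst degree_mult_eq) auto
  obtain c where "w * v = u * c" using Suc.prems(1) by (rule dvdE)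
  hence "poly (w * v) z = 0" using z by simp
  hence "poly w z = 0" using Suc.prems(2)[of z] z by auto
  then obtain w' where w': "w = [:- z, 1:] * w'" by (auto simp: poly_eq_0_iff_dvd)
  have "[:- z, 1:] * u' dvd [:- z, 1:] * (w' * v)"
    using Suc.prems(1) unfolding u' w' by (simp only: mult.assoc)
  hence "u' dvd w' * v" unfolding dvd_mult_cancel_left by auto
  hence "u' dvd w'" using Suc.hyps(1)[of u' w'] Suc.hyps(2) Suc.prems(2) deg unfolding u' by fastforce
  thus ?case unfolding u' w' by (rule mult_dvd_mono[OF dvd_refl])
qed

text \<open>After splitting off a root \<open>x\<close>, the derivative at \<open>x\<close> is the
  value of the cofactor, so \<open>x\<close> is not a root of the cofactor.\<close>

lemma card_roots_simple:
  fixes f :: "'a::alg_closed_field poly"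
  assumes "f \<noteq> 0" "\<And>z. poly f z = 0 \<Longrightarrow> poly (pderiv f) z \<noteq> 0"
  shows "card {z. poly f z = 0} = degree f"
  using assms
proof (induction "degree f" arbitrary: f)
  case 0
  then obtain c where "f = [:c:]" "c \<noteq> 0" by (metis degree_eq_zeroE pCons_0_0)
  thus ?case by simp
next
  case (Suc n)
  obtain x where x: "poly f x = 0" using alg_closed_imp_poly_has_root[of f] Suc by auto
  then obtain g where g: "f = [:- x, 1:] * g" by (auto simp: poly_eq_0_iff_dvd)
  have g0: "g \<noteq> 0" using g Suc.prems by auto
  have deg: "degree f = Suc (degree g)" using g0 unfolding g by (subst degree_mult_eq) auto
  have gx: "poly g x \<noteq> 0"
    using Suc.prems(2)[OF x] unfolding g by (simp add: pderiv_mult pderiv_pCons del: mult_pCons_left)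
  have "poly (pderiv g) z \<noteq> 0" if "poly g z = 0" for z
    using Suc.prems(2)[of z] that unfolding g by (auto simp: pderiv_mult pderiv_pCons simp del: mult_pCons_left)
  hence "card {z. poly g z = 0} = degree g" using Suc.hyps(1)[of g] Suc.hyps(2) deg g0 by simp
  moreover have "{z. poly f z = 0} = insert x {z. poly g z = 0}" by (auto simp: g)
  ultimately show ?case using deg gx poly_roots_finite[OF g0] by simp
qed

text \<open>A double root is still a root of the cofactor, which thus has the same roots and one
  degree less.\<close>

lemma card_roots_double:
  fixes f :: "'a::field poly"
  assumes "f \<noteq> 0" "poly f x = 0" "poly (pderiv f) x = 0"
  shows "card {z. poly f z = 0} < degree f"
proof -
  obtain g where g: "f = [:- x, 1:] * g" using assms(2) by (auto simp: poly_eq_0_iff_dvd)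
  have g0: "g \<noteq> 0" using g assms by auto
  have deg: "degree f = Suc (degree g)" using g0 unfolding g by (subst degree_mult_eq) auto
  have gx: "poly g x = 0"
    using assms(3) unfolding g by (simp add: pderiv_mult pderiv_pCons del: mult_pCons_left)
  hence "{z. poly f z = 0} = {z. poly g z = 0}" by (auto simp: g)
  thus ?thesis using deg card_poly_roots_bound[OF g0] by simp
qed

lemma card_ev_fibre:
  fixes f g :: "'a::field poly"
  assumes "lowest_terms d f g" "d > 0" "a \<noteq> 0 \<or> b \<noteq> (0::'a)"
  defines "h \<equiv> smult b f - smult a g"
  shows "card (ev d f g -` {pt a b}) = card {z. poly h z = 0} + (if coeff h d = 0 then 1 else 0)"
proof -
  have "finite {z. poly h z = 0}"
    unfolding h_def by (rule poly_roots_finite[OF lowest_terms_combination_nonzero[OF assms(1-3)]])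
  thus ?thesis unfolding ev_fibre[OF assms(1,3)] h_def[symmetric]
    by (auto simp: card_insert_if)
qed

lemma degree_less_if_coeff_0: "degree h \<le> d \<Longrightarrow> coeff h d = 0 \<Longrightarrow> h \<noteq> 0 \<Longrightarrow> degree h < d"
  by (metis leading_coeff_0_iff le_neq_implies_less)

text \<open>When infinity belongs to the fibre, \<open>h\<close> loses at least one degree, which
  pays for the extra point.\<close>

lemma card_ev_fibre_le:
  fixes f g :: "'a::field poly"
  assumes "lowest_terms d f g" "d > 0"
  shows "card (ev d f g -` {y}) \<le> d"
proof -
  obtain a b where y: "y = pt a b" and ab: "a \<noteq> 0 \<or> b \<noteq> 0" by (rule pt_cases)
  define h where "h = smult b f - smult a g"
  have h: "h \<noteq> 0" "degree h \<le> d" unfolding h_def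
    using lowest_terms_combination_nonzero[OF assms ab] degree_combination[OF assms(1)] by auto
  show ?thesis unfolding y card_ev_fibre[OF assms ab] h_def[symmetric]
    using card_poly_roots_bound[OF h(1)] degree_less_if_coeff_0[OF h(2)] h by auto
qed

text \<open>With the values of \<open>f\<close> and \<open>g\<close> at \<open>z\<close> as
  coordinates, the derivative of \<open>h\<close> at \<open>z\<close> is the Wronskian there, so
  \<open>z\<close> is a double root of \<open>h\<close>.\<close>

lemma card_ev_fibre_less:
  fixes f g :: "'a::field poly"
  assumes "lowest_terms d f g" "d > 0" "poly (wronskian f g) z = 0"
  shows "card (ev d f g -` {ev d f g (Fin z)}) < d"
proof -
  define a b where "a = poly f z" and "b = poly g z"
  have ab: "a \<noteq> 0 \<or> b \<noteq> 0" using lowest_terms_poly[OF assms(1)] by (simp add: a_def b_def)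
  have y: "ev d f g (Fin z) = pt a b" by (simp add: ev_Fin a_def b_def)
  define h where "h = smult b f - smult a g"
  have h: "h \<noteq> 0" "degree h \<le> d" unfolding h_def
    using lowest_terms_combination_nonzero[OF assms(1,2) ab] degree_combination[OF assms(1)] by auto
  have "poly h z = 0" "poly (pderiv h) z = 0"
    using assms(3) by (auto simp: h_def a_def b_def wronskian_def pderiv_diff pderiv_smult mult.commute)
  from card_roots_double[OF h(1) this] show ?thesis
    unfolding y card_ev_fibre[OF assms(1,2) ab] h_def[symmetric]
    using degree_less_if_coeff_0[OF h(2)] h by auto
qed

text \<open>Here \<open>h\<close> has degree \<open>d\<close> and only simple roots: at a double
  root both \<open>a\<close> and \<open>b\<close> times the Wronskian would vanish.\<close>

lemma card_ev_fibre_eq: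
  fixes f g :: "'a::alg_closed_field poly"
  assumes "lowest_terms d f g" "d > 0" "y \<noteq> ev d f g Infty"
    "\<And>z. poly (wronskian f g) z = 0 \<Longrightarrow> y \<noteq> ev d f g (Fin z)"
  shows "card (ev d f g -` {y}) = d"
proof -
  obtain a b where y: "y = pt a b" and ab: "a \<noteq> 0 \<or> b \<noteq> 0" by (rule pt_cases)
  define h where "h = smult b f - smult a g"
  have fib: "ev d f g -` {y} = Fin ` {z. poly h z = 0} \<union> (if coeff h d = 0 then {Infty} else {})"
    unfolding y h_def by (rule ev_fibre[OF assms(1) ab])
  have h: "h \<noteq> 0" "degree h \<le> d" unfolding h_def
    using lowest_terms_combination_nonzero[OF assms(1,2) ab] degree_combination[OF assms(1)] by auto
  have "Infty \<notin> ev d f g -` {y}" using assms(3) by auto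
  hence top: "coeff h d \<noteq> 0" using fib by auto
  hence deg: "degree h = d" using h(2) le_degree by fastforce
  have "poly (pderiv h) z \<noteq> 0" if z: "poly h z = 0" for z
  proof
    assume "poly (pderiv h) z = 0"
    hence *: "b * poly f z = a * poly g z" "b * poly (pderiv f) z = a * poly (pderiv g) z"
      using z by (simp_all add: h_def pderiv_diff pderiv_smult)
    have "b * poly (wronskian f g) z = 0" "a * poly (wronskian f g) z = 0"
    proof -
      have "b * poly (wronskian f g) z = (b * poly (pderiv f) z) * poly g z - (b * poly f z) * poly (pderiv g) z"
        by (simp add: wronskian_def algebra_simps)
      also have "\<dots> = 0" unfolding * by simp
      finally show "b * poly (wronskian f g) z = 0" .
      have "a * poly (wronskian f g) z = poly (pderiv f) z * (a * poly g z) - poly f z * (a * poly (pderiv g) z)"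
        by (simp add: wronskian_def algebra_simps)
      also have "\<dots> = 0" unfolding *[symmetric] by simp
      finally show "a * poly (wronskian f g) z = 0" .
    qed
    hence "poly (wronskian f g) z = 0" using ab by auto
    moreover have "Fin z \<in> ev d f g -` {y}" using fib z by auto
    ultimately show False using assms(4) by auto
  qed
  from card_roots_simple[OF h(1) this] show ?thesis
    unfolding y card_ev_fibre[OF assms(1,2) ab] h_def[symmetric] using top deg by simp
qed

text \<open>The two products contribute \<open>n\<close> and \<open>n + 1\<close> times the same
  term, so the difference is that term up to sign in every characteristic.\<close>

lemma coeff_wronskian_top:
  fixes h f :: "'a::field poly"
  assumes "degree h = n" "degree f \<le> Suc n" "n > 0"
  shows "coeff (wronskian h f) (2 * n) = - (coeff h n * coeff f (Suc n))"
proof -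
  obtain m where n: "n = Suc m" using assms(3) by (cases n) auto
  have deg: "degree (pderiv h) \<le> m" "degree (pderiv f) \<le> n"
    using degree_pderiv_le[of h] degree_pderiv_le[of f] assms by (auto simp: n)
  have "coeff (pderiv h * f) (m + Suc n) = of_nat n * coeff h n * coeff f (Suc n)"
    unfolding coeff_mult_top[OF deg(1) assms(2)] by (simp add: n coeff_pderiv)
  moreover have "coeff (h * pderiv f) (n + n) = coeff h n * (of_nat (Suc n) * coeff f (Suc n))"
    unfolding coeff_mult_top[OF eq_refl[OF assms(1)] deg(2)] by (simp add: coeff_pderiv)
  moreover have "m + Suc n = 2 * n" "n + n = 2 * n" by (simp_all add: n)
  ultimately have "coeff (wronskian h f) (2 * n) =
      of_nat n * coeff h n * coeff f (Suc n) - coeff h n * (of_nat (Suc n) * coeff f (Suc n))"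
    unfolding wronskian_def by (metis coeff_diff)
  thus ?thesis by (simp add: algebra_simps)
qed

text \<open>
  A substitute for the Riemann-Hurwitz formula: if the Wronskian has no zero, then its degree
  shows that \<open>Infty\<close> is a ramification point.
\<close>
lemma exists_small_fibre:
  fixes f g :: "'a::alg_closed_field poly"
  assumes "lowest_terms d f g" "d > 1"
  shows "\<exists>y. card (ev d f g -` {y}) < d"
proof (cases "\<exists>z. poly (wronskian f g) z = 0")
  case True
  thus ?thesis using card_ev_fibre_less[OF assms(1)] assms(2) by auto
next
  case False
  hence deg_w: "degree (wronskian f g) = 0" using alg_closed_imp_poly_has_root by blast
  define a b where "a = coeff f d" and "b = coeff g d"
  have ab: "a \<noteq> 0 \<or> b \<noteq> 0" using lowest_terms_coeff[OF assms(1)] by (simp add: a_def b_def)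
  define h where "h = smult b f - smult a g"
  have h: "h \<noteq> 0" "degree h \<le> d" unfolding h_def
    using lowest_terms_combination_nonzero[OF assms(1) _ ab] degree_combination[OF assms(1)] assms(2) by auto
  have "coeff h d = 0" by (simp add: h_def a_def b_def)
  hence "degree h < d" using degree_less_if_coeff_0 h by blast
  \<comment> \<open>If \<open>h\<close> lost only one degree, the Wronskian would have a nonzero
    coefficient at \<open>2 * (d - 1)\<close>, although it is constant and
    \<open>d > 1\<close>.\<close>
  have "degree h \<noteq> d - 1"
  proof
    assume deg: "degree h = d - 1"
    have w: "wronskian h f = smult a (wronskian f g)" "wronskian h g = smult b (wronskian f g)"
      by (simp_all add: h_def wronskian_def pderiv_diff pderiv_smult smult_diff_right algebra_simps)
    have w0: "coeff (wronskian f g) (2 * (d - 1)) = 0" using deg_w assms(2) by (simp add: coeff_eq_0)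
    have top: "coeff (wronskian h u) (2 * (d - 1)) \<noteq> 0" if "degree u \<le> d" "coeff u d \<noteq> 0" for u
      using coeff_wronskian_top[OF deg, of u] that assms(2) h(1) deg leading_coeff_0_iff[of h] by auto
    show False using ab top[of f] top[of g] lowest_terms_degree[OF assms(1)] w w0
      by (auto simp: a_def b_def)
  qed
  hence "degree h + 1 < d" using \<open>degree h < d\<close> by simp
  hence "card (ev d f g -` {pt a b}) < d"
    using card_ev_fibre[OF assms(1) _ ab] card_poly_roots_bound[OF h(1)] assms(2)
    unfolding h_def[symmetric] by auto
  thus ?thesis by blast
qed

definition power_map :: "nat \<Rightarrow> 'a::field P1 \<Rightarrow> 'a P1" where
  "power_map q = map_P1 (\<lambda>z. z ^ q)"

lemma power_map_simps [simp]: "power_map q (Fin z) = Fin (z ^ q)" "power_map q Infty = Infty"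
  by (simp_all add: power_map_def)

text \<open>Counting points without multiplicity makes this insensitive to a bijective Frobenius
  power and compatible with Moebius changes of coordinates.\<close>

definition branch :: "('a P1 \<Rightarrow> 'a P1) \<Rightarrow> 'a P1 set" where
  "branch F = {y. \<exists>y'. card (F -` {y}) < card (F -` {y'})}"

context alg_closed_char_p
begin

section \<open>Splitting off Frobenius\<close>

text \<open>A vanishing derivative kills every coefficient whose index is not divisible by the
  characteristic; \<open>g\<close> collects the others.\<close>

lemma pderiv_0_imp_pcompose:
  fixes f :: "'a poly"
  assumes "pderiv f = 0" obtains g where "f = g \<circ>\<^sub>p monom 1 CHAR('a)"
proof
  define g where "g = (\<Sum>i\<le>degree f. monom (coeff f (CHAR('a) * i)) i)"
  have coeff_g: "coeff g i = coeff f (CHAR('a) * i)" for i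
  proof (cases "i \<le> degree f")
    case False
    hence "degree f < CHAR('a) * i" using CHAR_pos
      by (metis less_le_trans linorder_not_le mult.commute mult_le_mono2 nat_mult_1_right Suc_leI One_nat_def)
    thus ?thesis using False by (simp add: g_def coeff_sum coeff_eq_0)
  qed (simp add: g_def coeff_sum)
  show "f = g \<circ>\<^sub>p monom 1 CHAR('a)"
  proof (rule poly_eqI)
    fix n
    define i j where "i = n div CHAR('a)" and "j = n mod CHAR('a)"
    have n: "n = CHAR('a) * i + j" "j < CHAR('a)" using CHAR_pos by (simp_all add: i_def j_def)
    have "coeff f n = 0" if nz: "j \<noteq> 0"
    proof -
      have "\<not> CHAR('a) dvd n" using nz by (auto simp: j_def dvd_eq_mod_eq_0)
      moreover obtain m where m: "n = Suc m" using nz unfolding j_def by (cases n) auto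
      ultimately have "of_nat (Suc m) \<noteq> (0 :: 'a)" by (metis of_nat_eq_0_iff_char_dvd)
      moreover have "of_nat (Suc m) * coeff f (Suc m) = 0" using assms coeff_pderiv[of f m] by simp
      ultimately show ?thesis using m by simp
    qed
    thus "coeff f n = coeff (g \<circ>\<^sub>p monom 1 CHAR('a)) n"
      using coeff_pcompose_monom[OF n(2), of g i] n by (auto simp: coeff_g)
  qed
qed

text \<open>\<open>f\<close> divides \<open>pderiv f * g\<close>, hence \<open>pderiv f\<close>,
  whose degree is too small unless it vanishes; likewise for \<open>g\<close>.\<close>

lemma wronskian_0_imp:
  assumes "lowest_terms d f g" "wronskian f g = (0 :: 'a poly)"
  shows "pderiv f = 0" "pderiv g = 0"
proof -
  have dvd: "pderiv u = 0" if "coprime u v" "pderiv u * v = u * pderiv v" for u v :: "'a poly"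
  proof -
    have "u dvd pderiv u * v" using that(2) by simp
    hence "u dvd pderiv u" using coprime_poly_0[OF that(1)] by (rule dvd_mult_if_no_common_root)
    show ?thesis
    proof (rule ccontr)
      assume nz: "pderiv u \<noteq> 0"
      hence "degree u \<le> degree (pderiv u)" using \<open>u dvd pderiv u\<close> dvd_imp_degree_le by blast
      moreover have "degree (pderiv u) \<le> degree u - 1" by (rule degree_pderiv_le)
      ultimately have "degree u = 0" by simp
      thus False using nz by (metis degree_eq_zeroE pderiv_singleton)
    qed
  qed
  have "coprime f g" using assms(1) by (simp add: lowest_terms_def)
  moreover have "pderiv f * g = f * pderiv g" using assms(2) by (simp add: wronskian_def)
  ultimately show "pderiv f = 0" "pderiv g = 0" using dvd[of f g] dvd[of g f] by (simp_all add: coprime_commute mult.commute)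
qed

text \<open>As long as the Wronskian vanishes, a substitution \<open>z ^ p\<close> splits off, with
  \<open>p\<close> the characteristic, and the degree drops by the factor \<open>p\<close>. The
  separable part remains.\<close>

lemma frobenius_decomposition:
  fixes f g :: "'a poly"
  assumes "lowest_terms d f g" "d > 0"
  obtains r f\<^sub>1 g\<^sub>1 d\<^sub>1 where "d = CHAR('a) ^ r * d\<^sub>1" "lowest_terms d\<^sub>1 f\<^sub>1 g\<^sub>1" "wronskian f\<^sub>1 g\<^sub>1 \<noteq> 0"
    "f = f\<^sub>1 \<circ>\<^sub>p monom 1 (CHAR('a) ^ r)" "g = g\<^sub>1 \<circ>\<^sub>p monom 1 (CHAR('a) ^ r)"
proof -
  have "\<exists>r f\<^sub>1 g\<^sub>1 d\<^sub>1. d = CHAR('a) ^ r * d\<^sub>1 \<and> lowest_terms d\<^sub>1 f\<^sub>1 g\<^sub>1 \<and> wronskian f\<^sub>1 g\<^sub>1 \<noteq> 0 \<and>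
      f = f\<^sub>1 \<circ>\<^sub>p monom 1 (CHAR('a) ^ r) \<and> g = g\<^sub>1 \<circ>\<^sub>p monom 1 (CHAR('a) ^ r)"
    using assms
  proof (induction d arbitrary: f g rule: less_induct)
    case (less d)
    show ?case
    proof (cases "wronskian f g = 0")
      case False
      have "monom 1 1 = [:0, 1 :: 'a:]" by (simp add: monom_altdef)
      thus ?thesis using less.prems False
        by (intro exI[of _ 0] exI[of _ f] exI[of _ g] exI[of _ d]) simp
    next
      case True
      define p where "p = CHAR('a)"
      have p: "p > 1" using prime_CHAR prime_gt_1_nat by (simp add: p_def)
      obtain f2 g2 where f2: "f = f2 \<circ>\<^sub>p monom 1 p" and g2: "g = g2 \<circ>\<^sub>p monom 1 p"
        using pderiv_0_imp_pcompose wronskian_0_imp[OF less.prems(1) True] unfolding p_def by metis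
      define e where "e = max (degree f2) (degree g2)"
      have deg: "degree f = degree f2 * p" "degree g = degree g2 * p"
        by (simp_all add: f2 g2 degree_monom_eq)
      have d: "d = p * e" using less.prems(1)
        by (auto simp: lowest_terms_def deg e_def max_def mult.commute)
      \<comment> \<open>A common root of \<open>f2\<close> and \<open>g2\<close> would have a
        \<open>p\<close>-th root that is a common root of \<open>f\<close> and
        \<open>g\<close>.\<close>
      have "poly f2 z \<noteq> 0 \<or> poly g2 z \<noteq> 0" for z
      proof -
        obtain x where "x ^ p = z" using nth_root_exists[of p z] p by auto
        thus ?thesis using lowest_terms_poly[OF less.prems(1), of x]
          by (simp add: f2 g2 poly_pcompose poly_monom)
      qed
      hence lt: "lowest_terms e f2 g2"
        by (simp add: lowest_terms_def coprime_if_no_common_root e_def)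
      have "e < d" "e > 0" using p less.prems(2) unfolding d by auto
      from less.IH[OF this(1) lt this(2)] obtain r f\<^sub>1 g\<^sub>1 d\<^sub>1 where
        *: "e = p ^ r * d\<^sub>1" "lowest_terms d\<^sub>1 f\<^sub>1 g\<^sub>1" "wronskian f\<^sub>1 g\<^sub>1 \<noteq> 0"
          "f2 = f\<^sub>1 \<circ>\<^sub>p monom 1 (p ^ r)" "g2 = g\<^sub>1 \<circ>\<^sub>p monom 1 (p ^ r)"
        unfolding p_def by blast
      have "monom 1 (p ^ r) \<circ>\<^sub>p monom 1 p = (monom 1 (p ^ Suc r) :: 'a poly)"
        by (simp add: monom_altdef pcompose_hom.hom_power flip: power_mult)
      hence "f = f\<^sub>1 \<circ>\<^sub>p monom 1 (p ^ Suc r)" "g = g\<^sub>1 \<circ>\<^sub>p monom 1 (p ^ Suc r)"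
        by (simp_all add: f2 g2 * flip: pcompose_assoc)
      moreover have "d = p ^ Suc r * d\<^sub>1" by (simp add: d *)
      ultimately show ?thesis using *(2,3) unfolding p_def by blast
    qed
  qed
  thus ?thesis using that by blast
qed

lemma bij_power_map: "bij (power_map (CHAR('a) ^ r) :: 'a P1 \<Rightarrow> 'a P1)"
proof -
  have "inj (power_map (CHAR('a) ^ r) :: 'a P1 \<Rightarrow> 'a P1)"
    unfolding power_map_def by (intro P1.inj_map injI) (simp add: frob_inj)
  moreover have "\<exists>x. power_map (CHAR('a) ^ r) x = y" for y :: "'a P1"
  proof (cases y)
    case (Fin z)
    obtain w where "w ^ CHAR('a) ^ r = z" using nth_root_exists[of "CHAR('a) ^ r" z] CHAR_pos by auto
    thus ?thesis by (intro exI[of _ "Fin w"]) (simp add: Fin)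
  next
    case Infty thus ?thesis by (intro exI[of _ Infty]) simp
  qed
  ultimately show ?thesis unfolding bij_def surj_def by metis
qed

lemma ev_pcompose_monom:
  assumes "q > 0"
  shows "ev (q * d) (f \<circ>\<^sub>p monom 1 q) (g \<circ>\<^sub>p monom 1 q) = ev d f g \<circ> power_map q"
proof
  fix x show "ev (q * d) (f \<circ>\<^sub>p monom 1 q) (g \<circ>\<^sub>p monom 1 q) x = (ev d f g \<circ> power_map q) x"
    using assms by (cases x) (simp_all add: ev_Fin ev_Infty poly_pcompose poly_monom coeff_pcompose_x_pow_n)
qed

lemma card_vimage_bij: "bij s \<Longrightarrow> card (s -` A) = card A"
  by (metis bij_def card_vimage_inj subset_UNIV)

lemma ratmap_decomposition:
  assumes "ratmap d F" "d > 0"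
  obtains r d\<^sub>1 f\<^sub>1 g\<^sub>1 where "d = CHAR('a) ^ r * d\<^sub>1" "lowest_terms d\<^sub>1 f\<^sub>1 g\<^sub>1" "wronskian f\<^sub>1 g\<^sub>1 \<noteq> 0"
    "F = ev d\<^sub>1 f\<^sub>1 g\<^sub>1 \<circ> power_map (CHAR('a) ^ r)" "d\<^sub>1 > 0"
    "\<And>y. card (F -` {y :: 'a P1}) = card (ev d\<^sub>1 f\<^sub>1 g\<^sub>1 -` {y})"
proof -
  obtain f g where fg: "lowest_terms d f g" "F = ev d f g" using assms by (auto simp: ratmap_def)
  from fg(1) assms(2) obtain r f\<^sub>1 g\<^sub>1 d\<^sub>1 where 
    *: "d = CHAR('a) ^ r * d\<^sub>1" "lowest_terms d\<^sub>1 f\<^sub>1 g\<^sub>1" "wronskian f\<^sub>1 g\<^sub>1 \<noteq> 0"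
    "f = f\<^sub>1 \<circ>\<^sub>p monom 1 (CHAR('a) ^ r)" "g = g\<^sub>1 \<circ>\<^sub>p monom 1 (CHAR('a) ^ r)"
    by (rule frobenius_decomposition)
  have F: "F = ev d\<^sub>1 f\<^sub>1 g\<^sub>1 \<circ> power_map (CHAR('a) ^ r)"
    unfolding fg *(1,4,5) using CHAR_pos by (intro ev_pcompose_monom) simp
  have "card (F -` {y}) = card (ev d\<^sub>1 f\<^sub>1 g\<^sub>1 -` {y})" for y
    using card_vimage_bij[OF bij_power_map] by (simp only: F vimage_comp[symmetric])
  moreover have "d\<^sub>1 > 0" using assms(2) *(1) by (cases d\<^sub>1) auto
  ultimately show ?thesis using that[OF *(1-3) F] by blast
qed

end

lemma obtain_three:
  assumes "finite A" "card A \<ge> 3"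
  obtains x y z where "x \<in> A" "y \<in> A" "z \<in> A" "x \<noteq> y" "x \<noteq> z" "y \<noteq> z"
proof -
  obtain B where "B \<subseteq> A" "card B = 3" using obtain_subset_with_card_n[OF assms(2)] by metis
  thus ?thesis using that by (auto simp: card_3_iff)
qed

context alg_closed_char_p
begin

section \<open>Existence and location of branch points\<close>

lemma infinite_UNIV_P1: "infinite (UNIV :: 'a P1 set)"
proof
  assume "finite (UNIV :: 'a P1 set)"
  hence "finite (Fin ` k)" by (rule finite_subset[rotated]) simp
  thus False using infinite_k by simp
qed

text \<open>\<open>F\<close> enters through its fibre sizes only, so \<open>f\<close> and
  \<open>g\<close> may describe just its separable part.\<close>

lemma branch_subset_critical_values:
  fixes f g :: "'a poly"
  assumes "lowest_terms d f g" "d > 0" "\<And>y. card (F -` {y}) = card (ev d f g -` {y})"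
  shows "branch F \<subseteq> insert (ev d f g Infty) ((\<lambda>z. ev d f g (Fin z)) ` {z. poly (wronskian f g) z = 0})"
proof
  fix y assume "y \<in> branch F"
  then obtain y' where "card (ev d f g -` {y}) < card (ev d f g -` {y'})"
    unfolding branch_def assms(3) by auto
  hence "card (ev d f g -` {y}) \<noteq> d" using card_ev_fibre_le[OF assms(1,2), of y'] by simp
  thus "y \<in> insert (ev d f g Infty) ((\<lambda>z. ev d f g (Fin z)) ` {z. poly (wronskian f g) z = 0})"
    using card_ev_fibre_eq[OF assms(1,2), of y] by auto
qed

lemma finite_branch:
  assumes "ratmap d F" "d > 0" shows "finite (branch F :: 'a P1 set)"
proof -
  obtain d\<^sub>1 f\<^sub>1 g\<^sub>1 where *: "lowest_terms d\<^sub>1 f\<^sub>1 g\<^sub>1" "d\<^sub>1 > 0" "wronskian f\<^sub>1 g\<^sub>1 \<noteq> 0"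
    "\<And>y. card (F -` {y}) = card (ev d\<^sub>1 f\<^sub>1 g\<^sub>1 -` {y})"
    using ratmap_decomposition[OF assms] by metis
  show ?thesis
    by (rule finite_subset[OF branch_subset_critical_values[OF *(1,2,4)]])
       (simp add: poly_roots_finite[OF *(3)])
qed

lemma exists_full_fibre:
  fixes f g :: "'a poly"
  assumes "lowest_terms d f g" "d > 0" "wronskian f g \<noteq> 0"
  obtains y where "card (ev d f g -` {y}) = d"
proof -
  have "finite (insert (ev d f g Infty) ((\<lambda>z. ev d f g (Fin z)) ` {z. poly (wronskian f g) z = 0}))"
    by (simp add: poly_roots_finite[OF assms(3)])
  then obtain y where y: "y \<notin> insert (ev d f g Infty) ((\<lambda>z. ev d f g (Fin z)) ` {z. poly (wronskian f g) z = 0})"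
    using infinite_UNIV_P1 by (metis ex_new_if_finite)
  show ?thesis by (rule that, rule card_ev_fibre_eq[OF assms(1,2)]) (use y in auto)
qed

text \<open>A separable part of degree 1 would make \<open>F\<close> injective. In higher degree
  some fibre is small, while a general one is full.\<close>

lemma branch_nonempty:
  assumes "ratmap d F" "d > 0" "\<not> inj F" shows "branch F \<noteq> ({} :: 'a P1 set)"
proof -
  obtain d\<^sub>1 f\<^sub>1 g\<^sub>1 where *: "lowest_terms d\<^sub>1 f\<^sub>1 g\<^sub>1" "d\<^sub>1 > 0" "wronskian f\<^sub>1 g\<^sub>1 \<noteq> 0"
    "\<And>y. card (F -` {y}) = card (ev d\<^sub>1 f\<^sub>1 g\<^sub>1 -` {y})"
    using ratmap_decomposition[OF assms(1,2)] by metis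
  have "d\<^sub>1 \<noteq> 1"
  proof
    assume "d\<^sub>1 = 1"
    hence le1: "card (F -` {y}) \<le> 1" for y using card_ev_fibre_le[OF *(1,2)] *(4) by simp
    have "inj F"
    proof (rule injI)
      fix u v assume "F u = F v"
      hence "{u, v} \<subseteq> F -` {F u}" by auto
      hence "card {u, v} \<le> 1" using le1[of "F u"] ratmap_finite_fibre[OF assms(1,2)]
        by (meson card_mono le_trans)
      thus "u = v" by (cases "u = v") auto
    qed
    thus False using assms(3) by simp
  qed
  hence "d\<^sub>1 > 1" using *(2) by simp
  then obtain y where "card (ev d\<^sub>1 f\<^sub>1 g\<^sub>1 -` {y}) < d\<^sub>1" using exists_small_fibre[OF *(1)] by blast
  moreover obtain y' where "card (ev d\<^sub>1 f\<^sub>1 g\<^sub>1 -` {y'}) = d\<^sub>1" by (rule exists_full_fibre[OF *(1-3)])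
  ultimately have "y \<in> branch F" unfolding branch_def *(4) by (metis (mono_tags) mem_Collect_eq)
  thus ?thesis by blast
qed

text \<open>Removing Frobenius only reindexes coefficients, so the Wronskian of the separable part
  is over \<open>k\<close>, and critical points and their values lie in \<open>Pk\<close>.\<close>

lemma branch_subset_Pk:
  fixes f g :: "'a poly"
  assumes "lowest_terms d f g" "d > 0" "over_k f" "over_k g"
  shows "branch (ev d f g) \<subseteq> Pk"
proof
  fix y assume y: "y \<in> branch (ev d f g)"
  obtain r f\<^sub>1 g\<^sub>1 d\<^sub>1 where *: "d = CHAR('a) ^ r * d\<^sub>1" "lowest_terms d\<^sub>1 f\<^sub>1 g\<^sub>1" "wronskian f\<^sub>1 g\<^sub>1 \<noteq> 0"
    "f = f\<^sub>1 \<circ>\<^sub>p monom 1 (CHAR('a) ^ r)" "g = g\<^sub>1 \<circ>\<^sub>p monom 1 (CHAR('a) ^ r)"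
    by (rule frobenius_decomposition[OF assms(1,2)])
  have q: "CHAR('a) ^ r \<noteq> 0" using CHAR_pos by simp
  have d1: "d\<^sub>1 > 0" using assms(2) *(1) by (cases d\<^sub>1) auto
  have card: "card (ev d f g -` {y}) = card (ev d\<^sub>1 f\<^sub>1 g\<^sub>1 -` {y})" for y
    unfolding *(1,4,5) ev_pcompose_monom[OF q[unfolded neq0_conv]] vimage_comp[symmetric]
    by (rule card_vimage_bij[OF bij_power_map])
  have over: "over_k f\<^sub>1" "over_k g\<^sub>1"
    using assms(3,4) coeff_pcompose_x_pow_n[OF q, of f\<^sub>1] coeff_pcompose_x_pow_n[OF q, of g\<^sub>1]
    unfolding over_k_def *(4,5) by metis+
  have "ev d\<^sub>1 f\<^sub>1 g\<^sub>1 Infty \<in> Pk" using over by (auto simp: ev_Infty over_k_def intro!: pt_in_Pk)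
  moreover have "ev d\<^sub>1 f\<^sub>1 g\<^sub>1 (Fin z) \<in> Pk" if "poly (wronskian f\<^sub>1 g\<^sub>1) z = 0" for z
  proof -
    have "over_k (wronskian f\<^sub>1 g\<^sub>1)" unfolding wronskian_def
      by (intro over_k_diff over_k_mult over_k_pderiv over)
    hence "z \<in> k" using k_root *(3) that by blast
    thus ?thesis unfolding ev_Fin by (intro pt_in_Pk poly_in_k over)
  qed
  ultimately show "y \<in> Pk"
    using branch_subset_critical_values[OF *(2) d1 card] y by auto
qed

text \<open>Coordinate changes on source and target put both structures at \<open>Pk\<close>, where
  the map is defined over \<open>k\<close>; fibre sizes are unaffected.\<close>

lemma branch_subset_k_structure:
  assumes "ratmap d F" "d > 0" "k_structure U" "k_structure (F -` U)"
  shows "branch F \<subseteq> U"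
proof
  fix y assume y: "y \<in> branch F"
  obtain \<tau> where \<tau>: "ratmap 1 \<tau>" "U = \<tau> -` Pk" using assms(3) by (auto simp: k_structure_def)
  obtain \<sigma> where \<sigma>: "ratmap 1 \<sigma>" "F -` U = \<sigma> -` Pk" using assms(4) by (auto simp: k_structure_def)
  obtain \<rho> where \<rho>: "ratmap 1 \<rho>" "\<sigma> \<circ> \<rho> = id" "\<rho> \<circ> \<sigma> = id" using \<sigma>(1) by (rule ratmap_1_inverse)
  have bij: "bij \<rho>" "inj \<tau>" using \<rho>(1) \<tau>(1) ratmap_1_bij bij_is_inj by blast+
  define G where "G = \<tau> \<circ> F \<circ> \<rho>"
  have G: "ratmap d G" unfolding G_def by (intro ratmap_comp_left ratmap_comp_right assms \<tau> \<rho>)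
  have "G -` Pk = \<rho> -` (F -` U)" unfolding G_def \<tau>(2) by (simp add: vimage_comp comp_assoc)
  also have "\<dots> = (\<sigma> \<circ> \<rho>) -` Pk" unfolding \<sigma>(2) by (simp add: vimage_comp)
  finally have "G -` Pk = Pk" by (simp add: \<rho>)
  hence "G -` {Fin 0, Fin 1, Infty} \<subseteq> Pk" by force
  then obtain f g where fg: "lowest_terms d f g" "G = ev d f g" "over_k f" "over_k g"
    using over_k_if_fibres_in_Pk[OF G assms(2)] by blast
  have card: "card (G -` {\<tau> x}) = card (F -` {x})" for x
  proof -
    have "G -` {\<tau> x} = \<rho> -` (F -` {x})" using bij(2) by (auto simp: G_def inj_eq)
    thus ?thesis using card_vimage_bij[OF bij(1)] by simp
  qed
  have "\<tau> y \<in> branch G" using y unfolding branch_def by (auto simp flip: card)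
  hence "\<tau> y \<in> Pk" using branch_subset_Pk[OF fg(1) assms(2) fg(3,4)] fg(2) by auto
  thus "y \<in> U" by (simp add: \<tau>(2))
qed

text \<open>
  An injective \<open>F\<close> is a Moebius map composed with a power \<open>z ^ q\<close> of the Frobenius map. Such
  a map has \<open>q + 1\<close> fixed points: this replaces the use of Lang's theorem.
\<close>
lemma k_invariant_if_inj:
  assumes "ratmap d F" "d > 1" "inj (F :: 'a P1 \<Rightarrow> 'a P1)"
  shows "k_invariant F"
proof -
  have d0: "d > 0" using assms(2) by simp
  obtain r d\<^sub>1 f\<^sub>1 g\<^sub>1 where *: "d = CHAR('a) ^ r * d\<^sub>1" "lowest_terms d\<^sub>1 f\<^sub>1 g\<^sub>1" "wronskian f\<^sub>1 g\<^sub>1 \<noteq> 0"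
    "F = ev d\<^sub>1 f\<^sub>1 g\<^sub>1 \<circ> power_map (CHAR('a) ^ r)" "d\<^sub>1 > 0"
    "\<And>y. card (F -` {y}) = card (ev d\<^sub>1 f\<^sub>1 g\<^sub>1 -` {y})"
    using ratmap_decomposition[OF assms(1) d0] by metis
  obtain y where "card (F -` {y}) = d\<^sub>1" using exists_full_fibre[OF *(2,5,3)] *(6) by metis
  moreover have "card (F -` {y}) \<le> 1"
    using card_vimage_inj_on_le[OF assms(3), of "{y}"] by simp
  ultimately have d1: "d\<^sub>1 = 1" using *(5) by simp
  define q where "q = CHAR('a) ^ r"
  have q: "q > 1" using assms(2) *(1) d1 by (simp add: q_def)
  hence "r > 0" unfolding q_def by (cases r) auto
  hence of_nat_q: "of_nat q = (0 :: 'a)" by (simp add: q_def power_0_left)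
  have "ratmap 1 (ev d\<^sub>1 f\<^sub>1 g\<^sub>1)" using *(2) d1 by (auto simp: ratmap_def)
  then obtain a b c e where det: "a * e - b * c \<noteq> 0" and ev1: "ev d\<^sub>1 f\<^sub>1 g\<^sub>1 = ev 1 [:b, a:] [:e, c:]"
    by (rule ratmap_1E)
  have F: "F = ev 1 [:b, a:] [:e, c:] \<circ> power_map q" by (simp add: *(4) ev1 q_def)
  \<comment> \<open>The roots of \<open>P\<close> are the finite fixed points. They are simple
    because \<open>q\<close> vanishes in the field: at a double root, numerator and denominator of
    \<open>F\<close> would both be zero.\<close>
  define P where "P = monom a q + [:b:] - monom c (Suc q) - [:0, e:]"
  have P: "poly P z = a * z ^ q + b - z * (c * z ^ q + e)" for z
    by (simp add: P_def poly_monom algebra_simps)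
  have "pderiv P = - monom c q - [:e:]"
    using q by (simp add: P_def pderiv_add pderiv_diff pderiv_monom of_nat_q pderiv_pCons)
  hence P': "poly (pderiv P) z = - (c * z ^ q + e)" for z by (simp add: poly_monom)
  have nondeg: "c * w + e \<noteq> 0 \<or> a * w + b \<noteq> 0" for w
    using lowest_terms_poly[OF lowest_terms_linear[OF det], of w] by (auto simp: algebra_simps)
  have coeff_P: "coeff P (Suc q) = - c" "coeff P q = a - (if q = 1 then e else 0)"
    using q by (simp_all add: P_def coeff_pCons split: nat.split)
  have "coeff P (Suc q) \<noteq> 0 \<or> coeff P q \<noteq> 0" using det q coeff_P by auto
  hence P0: "P \<noteq> 0" by auto
  have "poly (pderiv P) z \<noteq> 0" if "poly P z = 0" for z
  proof
    assume "poly (pderiv P) z = 0"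
    hence "c * z ^ q + e = 0" by (simp only: P' neg_equal_0_iff_equal)
    thus False using that nondeg[of "z ^ q"] by (simp add: P)
  qed
  from card_roots_simple[OF P0 this] have card_roots: "card {z. poly P z = 0} = degree P" by blast
  have fixed: "F (Fin z) = Fin z" if "poly P z = 0" for z
  proof -
    have eq: "a * z ^ q + b = z * (c * z ^ q + e)" using that by (simp add: P)
    hence "c * z ^ q + e \<noteq> 0" using nondeg[of "z ^ q"] by auto
    moreover have "F (Fin z) = pt (a * z ^ q + b) (c * z ^ q + e)"
      by (simp add: F ev_Fin algebra_simps)
    ultimately show ?thesis unfolding eq by simp
  qed
  \<comment> \<open>If \<open>c = 0\<close>, infinity is fixed and \<open>P\<close> has degree at
    least \<open>q\<close>; otherwise \<open>P\<close> has degree at least \<open>q + 1\<close>.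
    Both cases give at least \<open>q + 1\<close> fixed points.\<close>
  define A where "A = Fin ` {z. poly P z = 0} \<union> (if c = 0 then {Infty} else {})"
  have fixA: "F x = x" if "x \<in> A" for x
    using that fixed by (auto simp: A_def F ev_Infty split: if_splits)
  have finA: "finite A" using poly_roots_finite[OF P0] by (simp add: A_def)
  have "card A \<ge> 3"
  proof (cases "c = 0")
    case True
    have "degree P \<ge> q" using det True coeff_P q by (intro le_degree) auto
    thus ?thesis using True q card_roots poly_roots_finite[OF P0]
      by (simp add: A_def card_insert_if image_iff)
  next
    case False
    have "degree P \<ge> Suc q" using False coeff_P by (intro le_degree) auto
    thus ?thesis using False q card_roots by (simp add: A_def)
  qed
  then obtain x y z where "x \<in> A" "y \<in> A" "z \<in> A" "x \<noteq> y" "x \<noteq> z" "y \<noteq> z"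
    using obtain_three[OF finA] by metis
  thus ?thesis using k_invariant_if_three_fixed[OF assms(1) d0 assms(3)] fixA by metis
qed

end

section \<open>Invariant structures\<close>

lemma poly_only_root_0:
  fixes f :: "'a::alg_closed_field poly"
  assumes "f \<noteq> 0" "\<And>z. poly f z = 0 \<Longrightarrow> z = 0"
  shows "f = monom (lead_coeff f) (degree f)"
proof -
  obtain A where A: "size A = degree f" "f = smult (lead_coeff f) (\<Prod>x\<in>#A. [:- x, 1:])"
    using alg_closed_imp_factorization[OF assms(1)] by auto
  have "x = 0" if "x \<in># A" for x
  proof (rule assms(2))
    have "poly (\<Prod>x\<in>#A. [:- x, 1:]) x = 0" using that by (auto simp: poly_prod_mset)
    thus "poly f x = 0" by (subst A(2)) simp
  qed
  hence "(\<Prod>x\<in>#A. [:- x, 1:]) = (\<Prod>x\<in>#A. [:0, 1:])"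
    by (intro arg_cong[of _ _ prod_mset] image_mset_cong) auto
  also have "\<dots> = [:0, 1:] ^ degree f" by (simp add: A(1))
  finally show ?thesis by (subst A(2)) (simp add: monom_altdef)
qed

context alg_closed_char_p
begin

text \<open>\<open>F\<close> is a multiple of \<open>z ^ d\<close> or of its reciprocal. For a
  nonzero fixed point \<open>\<mu>\<close>, the fibre over \<open>\<mu>\<close> consists of
  \<open>\<mu>\<close> times roots of unity, so the fibres over 0, \<open>\<mu>\<close> and infinity
  lie in the line \<open>Pk\<close> scaled by \<open>\<mu>\<close>.\<close>

lemma k_invariant_if_fixes_0_Infty:
  assumes "ratmap d F" "d > 1" "F -` {Fin 0, Infty} = {Fin 0, Infty :: 'a P1}"
  shows "k_invariant F"
proof -
  have d0: "d > 0" using assms(2) by simp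
  obtain f g where fg: "lowest_terms d f g" "F = ev d f g" using assms(1) by (auto simp: ratmap_def)
  have surj: "surj F" by (rule ratmap_surj[OF assms(1) d0])
  have root_f: "F (Fin z) = Fin 0" if "poly f z = 0" for z
    using that lowest_terms_poly[OF fg(1), of z] by (simp add: fg ev_Fin pt_def)
  have root_g: "F (Fin z) = Infty" if "poly g z = 0" for z
    using that by (simp add: fg ev_Fin pt_def)
  have only: "z = 0" if "F (Fin z) = Fin 0 \<or> F (Fin z) = Infty" for z
  proof -
    have "Fin z \<in> F -` {Fin 0, Infty}" using that by auto
    thus ?thesis unfolding assms(3) by auto
  qed
  have f0: "f \<noteq> 0" and g0: "g \<noteq> 0"
    using lowest_terms_combination_nonzero[OF fg(1) d0, of 0 1]
      lowest_terms_combination_nonzero[OF fg(1) d0, of 1 0] by auto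
  have const: "u = [:lead_coeff u:]" if "\<And>z. poly u z \<noteq> 0" for u :: "'a poly"
    using that alg_closed_imp_poly_has_root[of u] by (metis degree_eq_zeroE lead_coeff_pCons(2) neq0_conv)
  have vals: "F (Fin 0) \<in> {Fin 0, Infty}" "F Infty \<in> {Fin 0, Infty}" using assms(3) by auto
  \<comment> \<open>Otherwise one of the two points would be missed by the surjective
    \<open>F\<close>.\<close>
  have distinct: "F (Fin 0) \<noteq> F Infty"
  proof
    assume eq: "F (Fin 0) = F Infty"
    obtain y where y: "y \<in> {Fin 0, Infty}" "y \<noteq> F Infty"
      using vals by (metis P1.distinct(1) insertCI)
    obtain x where x: "F x = y" using surj by (metis surj_def)
    hence "x \<in> F -` {Fin 0, Infty}" using y by simp
    hence "x \<in> {Fin 0, Infty}" by (simp only: assms(3))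
    thus False using x y eq by auto
  qed
  have "\<exists>\<mu>. \<mu> \<noteq> 0 \<and> (\<forall>z. z \<noteq> 0 \<longrightarrow> F (Fin z) = Fin \<mu> \<longrightarrow> z ^ d = \<mu> ^ d)"
  proof (cases "F Infty = Infty")
    case True
    hence F0: "F (Fin 0) = Fin 0" using vals distinct by auto
    have g: "g = [:lead_coeff g:]"
    proof (rule const)
      fix z show "poly g z \<noteq> 0" using root_g[of z] only[of z] F0 by auto
    qed
    define \<beta> where "\<beta> = lead_coeff g"
    have g: "g = [:\<beta>:]" "\<beta> \<noteq> 0" using g g0 by (simp_all add: \<beta>_def)
    have "coeff f d \<noteq> 0" using lowest_terms_coeff[OF fg(1)] d0 by (auto simp: g coeff_pCons split: nat.splits)
    hence "degree f = d" using lowest_terms_degree(1)[OF fg(1)] le_degree by fastforce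
    moreover have "f = monom (lead_coeff f) (degree f)"
      by (rule poly_only_root_0[OF f0]) (use root_f only in blast)
    ultimately obtain \<alpha> where f: "f = monom \<alpha> d" "\<alpha> \<noteq> 0" using f0 by (metis leading_coeff_0_iff)
    \<comment> \<open>This choice makes \<open>\<mu>\<close> a fixed point of \<open>F\<close>;
      likewise for the exponent \<open>d + 1\<close> in the reciprocal case.\<close>
    obtain \<mu> where \<mu>: "\<mu> ^ (d - 1) = \<beta> / \<alpha>" using nth_root_exists[of "d - 1" "\<beta> / \<alpha>"] assms(2) by auto
    have "\<mu> \<noteq> 0" using \<mu> f g assms(2) by (auto simp: power_0_left)
    moreover have "z ^ d = \<mu> ^ d" if "F (Fin z) = Fin \<mu>" for z
    proof -
      have "\<mu> ^ d = \<mu> ^ (d - 1) * \<mu>" using d0 by (metis power_minus_mult)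
      hence "\<alpha> * \<mu> ^ d = \<beta> * \<mu>" using f(2) \<mu> by simp
      moreover have "\<alpha> * z ^ d = \<beta> * \<mu>"
        using that f g by (simp add: fg ev_Fin poly_monom field_simps)
      ultimately have "\<alpha> * z ^ d = \<alpha> * \<mu> ^ d" by simp
      thus ?thesis using f(2) by simp
    qed
    ultimately show ?thesis by blast
  next
    case False
    hence F0: "F (Fin 0) = Infty" "F Infty = Fin 0" using vals distinct by auto
    have f: "f = [:lead_coeff f:]"
    proof (rule const)
      fix z show "poly f z \<noteq> 0" using root_f[of z] only[of z] F0(1) by auto
    qed
    define \<alpha> where "\<alpha> = lead_coeff f"
    have f: "f = [:\<alpha>:]" "\<alpha> \<noteq> 0" using f f0 by (simp_all add: \<alpha>_def)
    have "coeff g d \<noteq> 0" using lowest_terms_coeff[OF fg(1)] d0 by (auto simp: f coeff_pCons split: nat.splits)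
    hence "degree g = d" using lowest_terms_degree(2)[OF fg(1)] le_degree by fastforce
    moreover have "g = monom (lead_coeff g) (degree g)"
      by (rule poly_only_root_0[OF g0]) (use root_g only in blast)
    ultimately obtain \<beta> where g: "g = monom \<beta> d" "\<beta> \<noteq> 0" using g0 by (metis leading_coeff_0_iff)
    obtain \<mu> where \<mu>: "\<mu> ^ (d + 1) = \<alpha> / \<beta>" using nth_root_exists[of "d + 1" "\<alpha> / \<beta>"] by auto
    have "\<mu> \<noteq> 0" using \<mu> f g by (auto simp: power_0_left)
    moreover have "z ^ d = \<mu> ^ d" if "z \<noteq> 0" "F (Fin z) = Fin \<mu>" for z
    proof -
      have "\<alpha> = \<beta> * \<mu> * \<mu> ^ d" using \<mu> g by (simp add: field_simps)
      moreover have "\<alpha> = \<beta> * \<mu> * z ^ d"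
        using that f g by (simp add: fg ev_Fin poly_monom field_simps)
      ultimately have "(\<beta> * \<mu>) * z ^ d = (\<beta> * \<mu>) * \<mu> ^ d" by simp
      thus ?thesis using g(2) \<open>\<mu> \<noteq> 0\<close> by simp
    qed
    ultimately show ?thesis by blast
  qed
  then obtain \<mu> where \<mu>: "\<mu> \<noteq> 0" "\<And>z. z \<noteq> 0 \<Longrightarrow> F (Fin z) = Fin \<mu> \<Longrightarrow> z ^ d = \<mu> ^ d" by blast
  define \<tau> where "\<tau> = affine (1 / \<mu>) 0"
  have \<tau>: "ratmap 1 \<tau>" unfolding \<tau>_def by (rule ratmap_affine) (use \<mu> in simp)
  have "F -` (\<tau> -` {Fin 0, Fin 1, Infty}) \<subseteq> \<tau> -` Pk"
  proof
    fix x assume x: "x \<in> F -` (\<tau> -` {Fin 0, Fin 1, Infty})"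
    show "x \<in> \<tau> -` Pk"
    proof (cases x)
      case (Fin z)
      show ?thesis
      proof (cases "z = 0")
        case False
        hence "F x \<noteq> Fin 0" "F x \<noteq> Infty" using only Fin by auto
        hence "F x = Fin \<mu>" using x \<mu>(1) by (cases "F x") (auto simp: \<tau>_def)
        hence "(z / \<mu>) ^ d = 1" using \<mu> False Fin by (simp add: power_divide)
        hence "z / \<mu> \<in> k" using k_nth_root[of "z / \<mu>" d] d0 by simp
        thus ?thesis by (simp add: Fin \<tau>_def)
      qed (simp add: Fin \<tau>_def)
    qed (simp add: \<tau>_def)
  qed
  from vimage_k_structure[OF assms(1) d0 k_structure_vimage_Pk[OF \<tau>] \<tau> this]
  show ?thesis using k_structure_vimage_Pk[OF \<tau>] k_invariant_def by blast
qed

lemma k_invariant_if_two: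
  assumes "ratmap d F" "d > 1" "u \<noteq> v" "F -` {u, v} = {u, v :: 'a P1}"
  shows "k_invariant F"
proof -
  obtain w where w: "w \<notin> {u, v}" using infinite_UNIV_P1 by (metis ex_new_if_finite finite.emptyI finite.insertI)
  obtain \<sigma> where \<sigma>: "ratmap 1 \<sigma>" "\<sigma> u = Infty" "\<sigma> v = Fin 0" 
    using exists_ratmap_three[of u v w] assms(3) w by auto
  obtain \<rho> where \<rho>: "ratmap 1 \<rho>" "\<sigma> \<circ> \<rho> = id" "\<rho> \<circ> \<sigma> = id" using \<sigma>(1) by (rule ratmap_1_inverse)
  have \<rho>': "\<sigma> (\<rho> x) = x" "\<rho> (\<sigma> x) = x" for x using \<rho> by (auto simp: fun_eq_iff)
  have "\<sigma> y \<in> {Fin 0, Infty} \<longleftrightarrow> y \<in> {u, v}" for y by (metis \<sigma>(2,3) \<rho>'(2) insert_iff singletonD)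
  hence "(\<sigma> \<circ> F \<circ> \<rho>) -` {Fin 0, Infty} = \<rho> -` (F -` {u, v})"
    by (simp only: vimage_def comp_apply mem_Collect_eq)
  also have "\<dots> = {Fin 0, Infty}" unfolding assms(4) by (auto simp: \<rho>' simp flip: \<sigma>(2,3))
  finally have "k_invariant (\<sigma> \<circ> F \<circ> \<rho>)"
    by (intro k_invariant_if_fixes_0_Infty[OF _ assms(2)] ratmap_comp_left ratmap_comp_right assms(1) \<sigma>(1) \<rho>(1))
  thus ?thesis by (rule k_invariant_conj[OF \<sigma>(1) \<rho>(2,3)])
qed

section \<open>Towers of affine lines\<close>

text \<open>If the Moebius map sends \<open>Infty\<close> to a finite \<open>a\<close>, then
  \<open>a\<close> is in \<open>k\<close> and \<open>1 / (z - a)\<close> preserves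
  \<open>Pk\<close>; composing with it leaves an affine map.\<close>

lemma k_structure_Infty:
  assumes "k_structure W" "Infty \<in> W"
  obtains c e where "c \<noteq> 0" "\<And>w. Fin (c * w + e) \<in> W \<longleftrightarrow> w \<in> k"
proof -
  obtain \<sigma> where \<sigma>: "ratmap 1 \<sigma>" "W = \<sigma> -` Pk" using assms(1) by (auto simp: k_structure_def)
  have "\<exists>\<tau>. ratmap 1 \<tau> \<and> \<tau> Infty = Infty \<and> W = \<tau> -` Pk"
  proof (cases "\<sigma> Infty")
    case Infty thus ?thesis using \<sigma> by blast
  next
    case (Fin a)
    hence a: "a \<in> k" using assms(2) \<sigma> by simp
    define \<rho> where "\<rho> = ev 1 [:1, 0:] [:- a, 1:]"
    have lt: "lowest_terms 1 [:1, 0:] [:- a, 1:]" by (rule lowest_terms_linear) simp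
    have "\<rho> -` Pk = Pk" unfolding \<rho>_def
      by (rule ev_vimage_Pk[OF lt]) (use a in \<open>auto intro!: over_k_pCons k_minus\<close>)
    hence "W = (\<rho> \<circ> \<sigma>) -` Pk" by (simp add: \<sigma> vimage_comp[symmetric])
    moreover have "ratmap 1 \<rho>" using lt by (auto simp: ratmap_def \<rho>_def)
    moreover have "(\<rho> \<circ> \<sigma>) Infty = Infty" by (simp add: Fin \<rho>_def ev_Fin)
    ultimately show ?thesis using ratmap_comp_left \<sigma>(1) by blast
  qed
  then obtain \<tau> where \<tau>: "ratmap 1 \<tau>" "\<tau> Infty = Infty" "W = \<tau> -` Pk" by blast
  obtain a b where ab: "a \<noteq> 0" "\<tau> = affine a b" by (rule ratmap_1_fix_Infty[OF \<tau>(1,2)])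
  show ?thesis
    by (rule that[of "1 / a" "- b / a"]) (use ab in \<open>auto simp: \<tau>(3) ab field_simps\<close>)
qed

text \<open>The roots of \<open>P\<close> lie in \<open>k\<close>, so \<open>P\<close> is over
  \<open>k\<close> up to a constant; a point with value 1, again in \<open>k\<close>, determines the
  constant.\<close>

lemma over_k_if_values:
  assumes "degree P > 0" "\<And>w. poly P w \<in> k \<longleftrightarrow> w \<in> k"
  shows "over_k P"
proof -
  have P0: "P \<noteq> 0" using assms(1) by auto
  define A where "A = smult (inverse (lead_coeff P)) P"
  have P: "P = smult (lead_coeff P) A" using P0 by (simp add: A_def)
  have "over_k A"
  proof (rule over_k_if_roots)
    fix x assume "poly A x = 0"
    hence "poly P x = 0" by (subst P) simp
    thus "x \<in> k" using assms(2)[of x] by simp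
  qed (use P0 in \<open>auto simp: A_def\<close>)
  have "degree (P + [:- 1:]) > 0" using assms(1) by (subst degree_add_eq_left) auto
  then obtain w where "poly (P + [:- 1:]) w = 0" using alg_closed_imp_poly_has_root by blast
  hence w: "poly P w = 1" by simp
  hence "w \<in> k" using assms(2)[of w] by simp
  hence Aw: "poly A w \<in> k" using poly_in_k[OF \<open>over_k A\<close>] by simp
  have "lead_coeff P * poly A w = 1" using w by (subst (asm) P) simp
  hence "lead_coeff P = inverse (poly A w)" by (metis inverse_unique mult.commute)
  hence "lead_coeff P \<in> k" using k_inverse[OF Aw] by simp
  thus ?thesis using over_k_smult \<open>over_k A\<close> P by metis
qed


text \<open>
  The hypothesis on \<open>branch\<close> makes \<open>F\<close> a polynomial \<open>f\<^sub>1 (z ^ q)\<close> with \<open>f\<^sub>1'\<close> a nonzero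
  constant. Comparing the coefficients of \<open>z ^ q\<close> and \<open>z ^ d\<close> shows that the affine lines
  \<open>W n\<close> are \<open>c k + e n\<close> with a common \<open>c\<close>. If two consecutive ones differ, then their distance
  is transcendental over \<open>k\<close>, which forces \<open>F\<close> to be additive up to a constant, and hence
  conjugate to an additive polynomial over \<open>k\<close> by a translation moving a fixed point to \<open>0\<close>.
\<close>
lemma k_invariant_if_polynomial_tower:
  assumes "ratmap d F" "d > 1" "\<not> inj F" "F -` {Infty} = {Infty}" "branch F \<subseteq> {Infty}"
    and W: "\<And>n. k_structure (W n)" "\<And>n. Infty \<in> W n" "\<And>n. F -` W n = W (Suc n)"
  shows "k_invariant F"
proof -
  have d0: "d > 0" using assms(2) by simp
  \<comment> \<open>Without finite poles the denominator is constant and can be scaled to 1.\<close>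
  obtain f where deg_f: "degree f = d" and F: "\<And>z. F (Fin z) = Fin (poly f z)"
    and lt: "lowest_terms d f 1" "F = ev d f 1"
  proof -
    obtain f g where fg: "lowest_terms d f g" "F = ev d f g" using assms(1) by (auto simp: ratmap_def)
    have "poly g z \<noteq> 0" for z
    proof
      assume "poly g z = 0"
      hence "Fin z \<in> F -` {Infty}" by (simp add: fg ev_Fin)
      thus False unfolding assms(4) by simp
    qed
    hence "degree g = 0" using alg_closed_imp_poly_has_root[of g] by auto
    moreover have "g \<noteq> 0" using lowest_terms_combination_nonzero[OF fg(1) d0, of 1 0] by simp
    ultimately obtain \<gamma> where g: "g = [:\<gamma>:]" "\<gamma> \<noteq> 0" by (metis degree_eq_zeroE pCons_0_0)
    define u where "u = smult (inverse \<gamma>) f"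
    have "smult (inverse \<gamma>) g = 1" using g by (simp add: one_pCons)
    hence lt: "lowest_terms d u 1" and F: "F = ev d u 1"
      using lowest_terms_smult[OF _ fg(1), of "inverse \<gamma>"] ev_smult[of "inverse \<gamma>" d f g] g fg(2)
      by (simp_all add: u_def one_pCons)
    have "degree u = d" using lt d0 by (auto simp: lowest_terms_def)
    moreover have "F (Fin z) = Fin (poly u z)" for z by (simp add: F ev_Fin)
    ultimately show ?thesis using that lt F by blast
  qed

  obtain r f\<^sub>1 g\<^sub>1 d\<^sub>1 where *: "d = CHAR('a) ^ r * d\<^sub>1" "lowest_terms d\<^sub>1 f\<^sub>1 g\<^sub>1" "wronskian f\<^sub>1 g\<^sub>1 \<noteq> 0"
    "f = f\<^sub>1 \<circ>\<^sub>p monom 1 (CHAR('a) ^ r)" "1 = g\<^sub>1 \<circ>\<^sub>p monom 1 (CHAR('a) ^ r)"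
    by (rule frobenius_decomposition[OF lt(1) d0])
  define q where "q = CHAR('a) ^ r"
  have q: "q > 0" using CHAR_pos by (simp add: q_def)
  have "degree g\<^sub>1 = 0" using arg_cong[OF *(5), of degree] q by (simp add: degree_monom_eq flip: q_def)
  then obtain \<gamma> where "g\<^sub>1 = [:\<gamma>:]" by (rule degree_eq_zeroE)
  hence g1: "g\<^sub>1 = 1" using *(5) by (simp add: one_pCons)
  have d1: "d\<^sub>1 > 0" using d0 *(1) by (cases d\<^sub>1) auto
  have card: "card (F -` {y}) = card (ev d\<^sub>1 f\<^sub>1 g\<^sub>1 -` {y})" for y
  proof -
    have "F = ev d\<^sub>1 f\<^sub>1 g\<^sub>1 \<circ> power_map (CHAR('a) ^ r)"
      using ev_pcompose_monom[OF q[unfolded q_def], of d\<^sub>1 f\<^sub>1 g\<^sub>1]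
      by (simp only: lt(2) *(1)[symmetric] *(4)[symmetric] *(5)[symmetric])
    thus ?thesis using card_vimage_bij[OF bij_power_map] by (simp only: vimage_comp[symmetric])
  qed
  obtain y\<^sub>1 where y1: "card (ev d\<^sub>1 f\<^sub>1 g\<^sub>1 -` {y\<^sub>1}) = d\<^sub>1" by (rule exists_full_fibre[OF *(2) d1 *(3)])
  \<comment> \<open>\<open>F\<close> has a branch point; for \<open>d\<^sub>1 = 1\<close> its fibre
    would be empty.\<close>
  have "d\<^sub>1 \<noteq> 1"
  proof
    assume d1_eq: "d\<^sub>1 = 1"
    obtain y y' where y: "card (F -` {y}) < card (F -` {y'})"
      using branch_nonempty[OF assms(1) d0 assms(3)] by (auto simp: branch_def)
    have "card (F -` {y}) = 0" using y card_ev_fibre_le[OF *(2) d1, of y'] card d1_eq by simp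
    moreover obtain x where "F x = y" using ratmap_surj[OF assms(1) d0] by (metis surj_def)
    hence "F -` {y} \<noteq> {}" by auto
    ultimately show False using ratmap_finite_fibre[OF assms(1) d0, of y] by simp
  qed
  hence qd: "q < d" using q d1 *(1) by (simp add: q_def)
  \<comment> \<open>A zero of the derivative of \<open>f\<^sub>1\<close> would give a finite branch
    point, so this derivative is a nonzero constant.\<close>
  have "wronskian f\<^sub>1 g\<^sub>1 = pderiv f\<^sub>1" by (simp add: wronskian_def g1)
  moreover have "poly (wronskian f\<^sub>1 g\<^sub>1) z \<noteq> 0" for z
  proof
    assume "poly (wronskian f\<^sub>1 g\<^sub>1) z = 0"
    hence "card (ev d\<^sub>1 f\<^sub>1 g\<^sub>1 -` {ev d\<^sub>1 f\<^sub>1 g\<^sub>1 (Fin z)}) < d\<^sub>1" by (rule card_ev_fibre_less[OF *(2) d1])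
    hence "ev d\<^sub>1 f\<^sub>1 g\<^sub>1 (Fin z) \<in> branch F" unfolding branch_def card using y1 by (metis (mono_tags) mem_Collect_eq)
    thus False using assms(5) by (auto simp: g1 ev_Fin)
  qed
  ultimately have "degree (pderiv f\<^sub>1) = 0" "pderiv f\<^sub>1 \<noteq> 0"
    using alg_closed_imp_poly_has_root[of "pderiv f\<^sub>1"] by auto
  then obtain s where s: "pderiv f\<^sub>1 = [:s:]" "s \<noteq> 0" by (metis degree_eq_zeroE pCons_0_0)

  have "\<exists>c e. c \<noteq> 0 \<and> (\<forall>w. Fin (c * w + e) \<in> W n \<longleftrightarrow> w \<in> k)" for n
    using k_structure_Infty[OF W(1,2)[of n]] by metis
  then obtain c e where c0: "\<And>n. c n \<noteq> 0" and ce: "\<And>n w. Fin (c n * w + e n) \<in> W n \<longleftrightarrow> w \<in> k"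
    by metis
  \<comment> \<open>\<open>P n\<close> is \<open>F\<close> read in the affine coordinates of
    \<open>W (Suc n)\<close> on the source and of \<open>W n\<close> on the target.\<close>
  define P where "P n = smult (1 / c n) (f \<circ>\<^sub>p [:e (Suc n), c (Suc n):] + [:- e n:])" for n
  have deg_comp: "degree (f \<circ>\<^sub>p [:e n, c n:]) = d" for n using c0[of n] deg_f by simp
  have deg_P: "degree (P n) = d" for n
    unfolding P_def using c0[of n] deg_comp[of "Suc n"] d0 degree_add_eq_left[of "[:- e n:]" "f \<circ>\<^sub>p [:e (Suc n), c (Suc n):]"]
    by simp
  have P: "c n * poly (P n) w + e n = poly f (c (Suc n) * w + e (Suc n))" for n w
    using c0[of n] by (simp add: P_def poly_pcompose algebra_simps)
  have P_in_k: "poly (P n) w \<in> k \<longleftrightarrow> w \<in> k" for n w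
  proof -
    have "poly (P n) w \<in> k \<longleftrightarrow> Fin (c n * poly (P n) w + e n) \<in> W n" by (simp add: ce)
    also have "\<dots> \<longleftrightarrow> Fin (c (Suc n) * w + e (Suc n)) \<in> F -` W n" by (simp add: P F)
    also have "\<dots> \<longleftrightarrow> w \<in> k" unfolding W(3) by (rule ce)
    finally show ?thesis .
  qed
  have over_P: "over_k (P n)" for n by (rule over_k_if_values) (use deg_P d0 P_in_k in auto)

  have coeff_d: "c n * coeff (P n) d = lead_coeff f * c (Suc n) ^ d" for n
  proof -
    have "coeff (f \<circ>\<^sub>p [:e (Suc n), c (Suc n):]) d = lead_coeff f * c (Suc n) ^ d"
      using lead_coeff_comp[of "[:e (Suc n), c (Suc n):]" f] c0[of "Suc n"] deg_f deg_comp[of "Suc n"] by simp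
    thus ?thesis using c0[of n] d0 by (simp add: P_def coeff_pCons split: nat.split)
  qed
  \<comment> \<open>The \<open>q\<close>-th power is additive, so this is the linear coefficient of
    \<open>f\<^sub>1\<close> after an affine substitution, which the constant derivative
    determines.\<close>
  have coeff_q: "c n * coeff (P n) q = s * c (Suc n) ^ q" for n
  proof -
    define E C where "E = e (Suc n)" and "C = c (Suc n)"
    have "monom 1 q \<circ>\<^sub>p [:E, C:] = ([:E:] + [:0, C:]) ^ q"
      by (simp add: monom_altdef pcompose_hom.hom_power pcompose_pCons)
    also have "\<dots> = [:E:] ^ q + [:0, C:] ^ q"
      by (rule freshmans_dream'[where n = r]) (simp_all add: prime_CHAR q_def)
    also have "\<dots> = [:E ^ q, C ^ q:] \<circ>\<^sub>p monom 1 q"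
      by (simp add: pcompose_pCons poly_const_pow monom_altdef smult_power flip: smult_power)
    finally have "f \<circ>\<^sub>p [:E, C:] = (f\<^sub>1 \<circ>\<^sub>p [:E ^ q, C ^ q:]) \<circ>\<^sub>p monom 1 q"
      unfolding *(4) q_def[symmetric] pcompose_assoc[symmetric] by simp
    hence "coeff (f \<circ>\<^sub>p [:E, C:]) q = coeff (f\<^sub>1 \<circ>\<^sub>p [:E ^ q, C ^ q:]) 1"
      using coeff_pcompose_x_pow_n[of q _ 1] q by simp
    also have "\<dots> = coeff (pderiv (f\<^sub>1 \<circ>\<^sub>p [:E ^ q, C ^ q:])) 0" by (simp add: coeff_pderiv)
    also have "\<dots> = s * C ^ q" by (simp add: pderiv_pcompose s pderiv_pCons)
    finally show ?thesis using c0[of n] q by (simp add: P_def E_def C_def coeff_pCons split: nat.split)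
  qed
  have lead0: "lead_coeff f \<noteq> 0" using deg_f d0 by auto
  \<comment> \<open>Dividing the two coefficient relations eliminates \<open>c n\<close>; the
    exponent \<open>d - q\<close> is positive, so roots can be taken in \<open>k\<close>
    later.\<close>
  have quot: "lead_coeff f / s * c (Suc n) ^ (d - q) \<in> k" for n
  proof -
    have "coeff (P n) q \<noteq> 0" using coeff_q[of n] s(2) c0[of "Suc n"] by auto
    moreover have pow: "c (Suc n) ^ d = c (Suc n) ^ q * c (Suc n) ^ (d - q)" using qd by (simp flip: power_add)
    moreover have "c n * (lead_coeff f * (coeff (P n) q * c (Suc n) ^ (d - q))) = c n * (s * coeff (P n) d)"
    proof -
      have "c n * (lead_coeff f * (coeff (P n) q * c (Suc n) ^ (d - q))) =
          lead_coeff f * c (Suc n) ^ (d - q) * (c n * coeff (P n) q)" by (simp add: ac_simps)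
      also have "\<dots> = s * (lead_coeff f * c (Suc n) ^ d)"
        unfolding coeff_q pow by (simp add: ac_simps)
      also have "\<dots> = c n * (s * coeff (P n) d)" unfolding coeff_d[symmetric] by (simp add: ac_simps)
      finally show ?thesis .
    qed
    ultimately have "lead_coeff f / s * c (Suc n) ^ (d - q) = coeff (P n) d / coeff (P n) q"
      using s(2) c0[of n] by (simp add: field_simps)
    thus ?thesis using over_P[of n] by (simp add: over_k_def k_divide)
  qed
  \<comment> \<open>The relation just proved concerns \<open>c (Suc n)\<close>, so the reference
    scale has index 1.\<close>
  define C where "C = c 1"
  have C0: "C \<noteq> 0" using c0 by (simp add: C_def)
  have C_ratio: "C / c (Suc n) \<in> k" "C / c (Suc n) \<noteq> 0" for n
  proof -
    have "(C / c (Suc n)) ^ (d - q) = (lead_coeff f / s * C ^ (d - q)) / (lead_coeff f / s * c (Suc n) ^ (d - q))"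
      using lead0 s(2) by (simp add: power_divide)
    also have "\<dots> \<in> k" using k_divide[OF quot[of 0] quot[of n]] by (simp add: C_def)
    finally show "C / c (Suc n) \<in> k" using k_nth_root qd by simp
    show "C / c (Suc n) \<noteq> 0" using C0 c0 by simp
  qed
  have Ce: "Fin (C * w + e (Suc n)) \<in> W (Suc n) \<longleftrightarrow> w \<in> k" for n w
  proof -
    have "C * w = c (Suc n) * (C / c (Suc n) * w)" using c0[of "Suc n"] by simp
    hence "Fin (C * w + e (Suc n)) \<in> W (Suc n) \<longleftrightarrow> C / c (Suc n) * w \<in> k" by (simp only: ce)
    also have "\<dots> \<longleftrightarrow> w \<in> k"
      using C_ratio[of n] k_mult[OF C_ratio(1)[of n], of w] k_divide[of "C / c (Suc n) * w" "C / c (Suc n)"] by auto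
    finally show ?thesis .
  qed

  \<comment> \<open>\<open>Q n\<close> is \<open>P (Suc n)\<close> after all scales are replaced by
    \<open>C\<close>.\<close>
  define Q where "Q n = smult (c (Suc n) / C) (P (Suc n) \<circ>\<^sub>p [:0, C / c (Suc (Suc n)):])" for n
  have over_Q: "over_k (Q n)" for n
    unfolding Q_def using C_ratio[of n] C_ratio[of "Suc n"] k_inverse[of "C / c (Suc n)"]
    by (intro over_k_smult over_k_pcompose over_P over_k_pCons) auto
  have Q: "C * poly (Q n) w + e (Suc n) = poly f (C * w + e (Suc (Suc n)))" for n w
    using P[of "Suc n" "w * (C / c (Suc (Suc n)))"] c0[of "Suc (Suc n)"] C0
    by (simp add: Q_def poly_pcompose mult.commute)
  have Q_in_k: "poly (Q n) w \<in> k \<longleftrightarrow> w \<in> k" for n w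
  proof -
    have "poly (Q n) w \<in> k \<longleftrightarrow> Fin (C * poly (Q n) w + e (Suc n)) \<in> W (Suc n)" by (simp add: Ce)
    also have "\<dots> \<longleftrightarrow> Fin (C * w + e (Suc (Suc n))) \<in> F -` W (Suc n)" by (simp add: Q F)
    also have "\<dots> \<longleftrightarrow> w \<in> k" unfolding W(3) by (rule Ce)
    finally show ?thesis .
  qed
  define e1 e2 e3 W2 W3 where "e1 = e (Suc 0)" and "e2 = e (Suc (Suc 0))" and "e3 = e (Suc (Suc (Suc 0)))"
    and "W2 = W (Suc (Suc 0))" and "W3 = W (Suc (Suc (Suc 0)))"
  note e_defs = e1_def e2_def e3_def W2_def W3_def
  have Q0: "C * poly (Q 0) w + e1 = poly f (C * w + e2)"
    and Q1: "C * poly (Q 1) w + e2 = poly f (C * w + e3)"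
    and W2: "Fin (C * w + e2) \<in> W2 \<longleftrightarrow> w \<in> k"
    and W3: "Fin (C * w + e3) \<in> W3 \<longleftrightarrow> w \<in> k" for w
    using Q[of 0 w] Q[of 1 w] Ce[of w "Suc 0"] Ce[of w "Suc (Suc 0)"] by (simp_all add: e_defs)
  \<comment> \<open>The displacement between the lines of \<open>W3\<close> and \<open>W2\<close> in
    units of \<open>C\<close>; if it lies in \<open>k\<close>, the lines coincide.\<close>
  define v where "v = (e3 - e2) / C"
  have v: "C * w + e3 = C * (w + v) + e2" for w using C0 by (simp add: v_def field_simps)
  show ?thesis
  proof (cases "v \<in> k")
    case True
    have "x \<in> W3 \<longleftrightarrow> x \<in> W2" for x
    proof (cases x)
      case (Fin z)
      define w where "w = (z - e3) / C"
      have z: "z = C * w + e3" using C0 by (simp add: w_def)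
      have "x \<in> W3 \<longleftrightarrow> w \<in> k" using W3[of w] by (simp add: Fin z)
      moreover have "x \<in> W2 \<longleftrightarrow> w + v \<in> k" using W2[of "w + v"] by (simp add: Fin z v)
      ultimately show ?thesis using k_add[OF _ True] k_diff[OF _ True, of "w + v"] by auto
    qed (simp add: e_defs W(2))
    hence "F -` W2 = W2" using W(3)[of "Suc (Suc 0)"] by (auto simp: e_defs)
    moreover have "k_structure W2" by (simp add: e_defs W(1))
    ultimately show ?thesis using k_invariant_def by blast
  next
    case False
    have additive_k: "poly (Q 0) (u + w) - poly (Q 0) u = poly (Q 0) w - poly (Q 0) 0" if w: "w \<in> k" for u w
    proof -
      \<comment> \<open>\<open>R\<close> is over \<open>k\<close> and vanishes at \<open>v\<close>,
        which is not in \<open>k\<close>; hence \<open>R\<close> is zero, and the identity at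
        \<open>v\<close> holds at every \<open>u\<close>.\<close>
      define R where "R = Q 0 \<circ>\<^sub>p [:w, 1:] - Q 0 - [:poly (Q 1) w - poly (Q 1) 0:]"
      have "over_k R" unfolding R_def using w
        by (intro over_k_diff over_k_pcompose over_Q over_k_pCons k_diff poly_in_k) auto
      have shift: "C * poly (Q 0) (x + v) + e1 = C * poly (Q 1) x + e2" for x
        by (simp only: Q0 Q1 v)
      have "C * (poly (Q 0) (w + v) - poly (Q 0) v) = (C * poly (Q 0) (w + v) + e1) - (C * poly (Q 0) (0 + v) + e1)"
        by (simp add: algebra_simps)
      also have "\<dots> = C * (poly (Q 1) w - poly (Q 1) 0)"
        unfolding shift by (simp add: algebra_simps)
      finally have "C * (poly (Q 0) (w + v) - poly (Q 0) v) = C * (poly (Q 1) w - poly (Q 1) 0)" .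
      hence "poly R v = 0" using C0 by (simp add: R_def poly_pcompose add.commute)
      hence "R = 0" using k_root[OF \<open>over_k R\<close>] False by blast
      hence "poly R u = 0" "poly R 0 = 0" for u by simp_all
      hence "poly (Q 0) (u + w) - poly (Q 0) u = poly (Q 1) w - poly (Q 1) 0"
        "poly (Q 0) w - poly (Q 0) 0 = poly (Q 1) w - poly (Q 1) 0" for u
        by (simp_all add: R_def poly_pcompose add.commute)
      thus ?thesis by simp
    qed
    have additive: "poly (Q 0) (u + w) - poly (Q 0) u = poly (Q 0) w - poly (Q 0) 0" for u w
    proof -
      \<comment> \<open>For fixed \<open>u\<close> the additivity defect is a polynomial vanishing
        on the infinite set \<open>k\<close>.\<close>
      define T where "T = Q 0 \<circ>\<^sub>p [:u, 1:] - Q 0 - [:poly (Q 0) u - poly (Q 0) 0:]"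
      have "poly T x = 0" if "x \<in> k" for x
        using additive_k[OF that, of u] by (simp add: T_def poly_pcompose algebra_simps)
      hence "k \<subseteq> {x. poly T x = 0}" by blast
      hence "infinite {x. poly T x = 0}" using infinite_k by (rule infinite_super)
      hence "T = 0" using poly_roots_finite by blast
      hence "poly T w = 0" by simp
      thus ?thesis by (simp add: T_def poly_pcompose algebra_simps)
    qed
    have "degree (f + [:0, - 1:]) > 0" using assms(2) deg_f by (subst degree_add_eq_left) auto
    then obtain z\<^sub>0 where "poly (f + [:0, - 1:]) z\<^sub>0 = 0" using alg_closed_imp_poly_has_root by blast
    hence z0: "poly f z\<^sub>0 = z\<^sub>0" by (simp add: add_eq_0_iff)
    define u where "u = (z\<^sub>0 - e2) / C"
    have u: "C * u + e2 = z\<^sub>0" using C0 by (simp add: u_def)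
    have f_shift: "poly f (C * w + z\<^sub>0) = C * (poly (Q 0) w - poly (Q 0) 0) + z\<^sub>0" for w
    proof -
      have "C * w + z\<^sub>0 = C * (u + w) + e2" by (simp add: u[symmetric] algebra_simps)
      hence "poly f (C * w + z\<^sub>0) = C * poly (Q 0) (u + w) + e1" by (simp only: Q0)
      also have "poly (Q 0) (u + w) = poly (Q 0) u + (poly (Q 0) w - poly (Q 0) 0)"
        using additive[of u w] by (simp add: algebra_simps)
      also have "C * (poly (Q 0) u + (poly (Q 0) w - poly (Q 0) 0)) + e1 = (C * poly (Q 0) u + e1) + C * (poly (Q 0) w - poly (Q 0) 0)"
        by (simp add: algebra_simps)
      also have "C * poly (Q 0) u + e1 = z\<^sub>0" using Q0[of u] u z0 by simp
      finally show ?thesis by (simp only: add.commute)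
    qed
    \<comment> \<open>The line through the fixed point \<open>z\<^sub>0\<close> with scale
      \<open>C\<close> will be totally invariant.\<close>
    define V where "V = affine (1 / C) (- z\<^sub>0 / C) -` Pk"
    have V: "Fin (C * w + z\<^sub>0) \<in> V \<longleftrightarrow> w \<in> k" for w
      using C0 by (simp add: V_def field_simps)
    have Q00: "poly (Q 0) 0 \<in> k" by (simp add: Q_in_k)
    have "x \<in> F -` V \<longleftrightarrow> x \<in> V" for x
    proof (cases x)
      case (Fin z)
      define w where "w = (z - z\<^sub>0) / C"
      have z: "z = C * w + z\<^sub>0" using C0 by (simp add: w_def)
      have "x \<in> F -` V \<longleftrightarrow> poly (Q 0) w - poly (Q 0) 0 \<in> k"
        by (simp only: Fin z vimage_eq F f_shift V)
      also have "\<dots> \<longleftrightarrow> poly (Q 0) w \<in> k"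
        using k_diff[OF _ Q00] k_add[OF _ Q00, of "poly (Q 0) w - poly (Q 0) 0"] by auto
      finally show ?thesis by (simp add: Q_in_k Fin z V)
    next
      case Infty
      have "F Infty = Infty" using assms(4) by auto
      thus ?thesis by (simp add: Infty V_def)
    qed
    hence "F -` V = V" by blast
    moreover have "k_structure V" unfolding V_def
      by (intro k_structure_vimage_Pk ratmap_affine) (use C0 in simp)
    ultimately show ?thesis using k_invariant_def by blast
  qed
qed


section \<open>Towers of structures\<close>

lemma card_vimage_conj:
  assumes "bij \<rho>" "\<sigma> \<circ> \<rho> = id" "\<rho> \<circ> \<sigma> = id"
  shows "card ((\<sigma> \<circ> F \<circ> \<rho>) -` {y}) = card (F -` {\<rho> y})"
proof -
  have "\<sigma> (\<rho> x) = x" for x using assms(2) by (simp add: fun_eq_iff)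
  moreover have "\<rho> (\<sigma> x) = x" for x using assms(3) by (simp add: fun_eq_iff)
  ultimately have "\<sigma> x = y \<longleftrightarrow> x = \<rho> y" for x by metis
  hence "(\<sigma> \<circ> F \<circ> \<rho>) -` {y} = \<rho> -` (F -` {\<rho> y})"
    unfolding vimage_def comp_apply by simp
  thus ?thesis using card_vimage_bij[OF assms(1)] by simp
qed

text \<open>
  Points lying in almost all \<open>W n\<close> form a totally invariant set \<open>V\<close> containing \<open>branch F\<close>,
  and two distinct sets \<open>W n\<close> share at most two points.
\<close>
lemma k_invariant_if_tower:
  assumes "ratmap d F" "d > 1" and W: "\<And>n. k_structure (W n)" "\<And>n. F -` W n = W (Suc n)"
  shows "k_invariant F"
proof (cases "inj F")
  case True
  thus ?thesis using k_invariant_if_inj[OF assms(1,2)] by simp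
next
  case False
  have d0: "d > 0" using assms(2) by simp
  define V where "V = (\<Union>m. \<Inter>n\<in>{m..}. W n)"
  have branch: "branch F \<subseteq> W n" for n
    using branch_subset_k_structure[OF assms(1) d0 W(1)[of n]] W(1)[of "Suc n"] by (simp add: W(2))
  obtain b where b: "b \<in> branch F" using branch_nonempty[OF assms(1) d0 False] by blast
  have branch_V: "branch F \<subseteq> V" using branch unfolding V_def by blast
  have V_iff: "x \<in> V \<longleftrightarrow> (\<exists>m. \<forall>n\<ge>m. x \<in> W n)" for x by (auto simp: V_def)
  have F_V: "F x \<in> V \<longleftrightarrow> x \<in> V" for x
  proof -
    have step: "F x \<in> W n \<longleftrightarrow> x \<in> W (Suc n)" for n using W(2)[of n] by auto
    show ?thesis
    proof
      assume "F x \<in> V"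
      then obtain m where m: "\<And>n. n \<ge> m \<Longrightarrow> F x \<in> W n" unfolding V_iff by blast
      have "x \<in> W n" if "n \<ge> Suc m" for n
        using that m[of "n - 1"] step[of "n - 1"] by (cases n) auto
      thus "x \<in> V" unfolding V_iff by blast
    next
      assume "x \<in> V"
      then obtain m where "\<And>n. n \<ge> m \<Longrightarrow> x \<in> W n" unfolding V_iff by blast
      hence "F x \<in> W n" if "n \<ge> m" for n using that step by simp
      thus "F x \<in> V" unfolding V_iff by blast
    qed
  qed
  show ?thesis
  \<comment> \<open>Three points of \<open>V\<close> make two consecutive structures equal;
    otherwise \<open>V\<close> has one or two points, one of them the branch point
    \<open>b\<close>.\<close>
  proof (cases "\<exists>x\<in>V. \<exists>y\<in>V. \<exists>z\<in>V. x \<noteq> y \<and> x \<noteq> z \<and> y \<noteq> z")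
    case True
    then obtain x y z where xyz: "x \<in> V" "y \<in> V" "z \<in> V" "x \<noteq> y" "x \<noteq> z" "y \<noteq> z" by blast
    then obtain m1 m2 m3 where "\<And>n. n \<ge> m1 \<Longrightarrow> x \<in> W n" "\<And>n. n \<ge> m2 \<Longrightarrow> y \<in> W n"
      "\<And>n. n \<ge> m3 \<Longrightarrow> z \<in> W n" unfolding V_iff by metis
    hence "{x, y, z} \<subseteq> W n" if "n \<ge> m1 + m2 + m3" for n using that by simp
    hence "W (m1 + m2 + m3) = W (Suc (m1 + m2 + m3))"
      by (intro k_structure_eq[OF W(1) W(1) xyz(4-6)]) auto
    thus ?thesis using W k_invariant_def by metis
  next
    case few: False
    show ?thesis
    proof (cases "V = {b}")
      case False
      then obtain b' where b': "b' \<in> V" "b' \<noteq> b" using b branch_V by blast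
      have "V = {b, b'}" using few b branch_V b' by blast
      moreover have "F -` V = V" using F_V by auto
      ultimately show ?thesis using k_invariant_if_two[OF assms(1,2)] b'(2) by metis
    next
      case True
      \<comment> \<open>Moving \<open>b\<close> to infinity turns \<open>F\<close> into a polynomial
        map branched only there.\<close>
      obtain \<sigma> where \<sigma>: "ratmap 1 \<sigma>" "\<sigma> b = Infty" by (rule exists_ratmap_to_Infty)
      obtain \<rho> where \<rho>: "ratmap 1 \<rho>" "\<sigma> \<circ> \<rho> = id" "\<rho> \<circ> \<sigma> = id" using \<sigma>(1) by (rule ratmap_1_inverse)
      have \<rho>': "\<sigma> (\<rho> x) = x" "\<rho> (\<sigma> x) = x" for x using \<rho> by (auto simp: fun_eq_iff)
      have bij: "bij \<rho>" "inj \<sigma>" "inj \<rho>" using \<rho>(1) \<sigma>(1) ratmap_1_bij bij_is_inj by blast+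
      have \<rho>_Infty: "\<rho> x = b \<longleftrightarrow> x = Infty" for x by (metis \<rho>' \<sigma>(2))
      define G where "G = \<sigma> \<circ> F \<circ> \<rho>"
      have G: "ratmap d G" unfolding G_def by (intro ratmap_comp_left ratmap_comp_right assms(1) \<sigma> \<rho>)
      have "F x = b \<longleftrightarrow> x = b" for x using F_V True by auto
      hence "G x = Infty \<longleftrightarrow> x = Infty" for x unfolding G_def comp_apply by (metis \<rho>_Infty \<rho>')
      hence G_Infty: "G -` {Infty} = {Infty}" by auto
      have "\<not> inj G"
      proof
        assume "inj G"
        hence "inj (\<rho> \<circ> G \<circ> \<sigma>)" by (intro inj_compose bij)
        moreover have "\<rho> \<circ> G \<circ> \<sigma> = F" by (auto simp: G_def \<rho>')
        ultimately show False using \<open>\<not> inj F\<close> by simp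
      qed
      moreover have "branch G \<subseteq> {Infty}"
      proof
        fix y assume "y \<in> branch G"
        hence "\<rho> y \<in> branch F"
          unfolding branch_def G_def card_vimage_conj[OF bij(1) \<rho>(2,3)] by blast
        hence "\<rho> y = b" using branch_V True by blast
        thus "y \<in> {Infty}" by (simp add: \<rho>_Infty)
      qed
      moreover have "k_structure (\<rho> -` W n)" for n by (rule k_structure_vimage_mobius[OF \<rho>(1) W(1)])
      moreover have "Infty \<in> \<rho> -` W n" for n
        using \<rho>_Infty[of Infty] b branch by auto
      moreover have "G -` (\<rho> -` W n) = \<rho> -` W (Suc n)" for n
        unfolding W(2)[symmetric] by (auto simp: G_def \<rho>')
      ultimately have "k_invariant G"
        by (intro k_invariant_if_polynomial_tower[OF G assms(2) _ G_Infty, of "\<lambda>n. \<rho> -` W n"])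
      thus ?thesis unfolding G_def by (rule k_invariant_conj[OF \<sigma>(1) \<rho>(2,3)])
    qed
  qed
qed

section \<open>From preimages of a point to a tower\<close>

lemma vimage_funpow_Suc: "(F ^^ Suc n) -` A = F -` ((F ^^ n) -` A)"
  by (auto simp: funpow_swap1)

text \<open>An infinite total orbit makes the preimages reach three points. From then on the
  structure containing a preimage is unique, and one at a late level descends to all earlier ones,
  which yields a tower.\<close>

lemma k_invariant_if_preimages_in_k_structures:
  assumes F: "ratmap d F" "d > 1"
    and infinite_orbit: "infinite {\<gamma>. \<exists>n. (F ^^ n) \<beta> = \<gamma> \<or> (F ^^ n) \<gamma> = \<beta>}"
    and often: "\<And>N. \<exists>n\<ge>N. \<exists>W. k_structure W \<and> (F ^^ n) -` {\<beta>} \<subseteq> W"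
  shows "k_invariant F"
proof (cases "inj F")
  case True
  thus ?thesis using k_invariant_if_inj[OF F] by simp
next
  case False
  have d0: "d > 0" using F(2) by simp
  define S where "S n = (F ^^ n) -` {\<beta>}" for n
  have S_Suc: "S (Suc n) = F -` S n" for n unfolding S_def by (rule vimage_funpow_Suc)
  have surj: "surj F" by (rule ratmap_surj[OF F(1) d0])
  have image_S: "F ` S (Suc n) = S n" for n unfolding S_Suc using surj by (rule surj_image_vimage_eq)
  have fin: "finite (S n)" for n
  proof (induction n)
    case 0 thus ?case by (simp add: S_def)
  next
    case (Suc n)
    have "S (Suc n) = (\<Union>y\<in>S n. F -` {y})" unfolding S_Suc by auto
    thus ?case using Suc ratmap_finite_fibre[OF F(1) d0] by simp
  qed
  have nonempty: "S n \<noteq> {}" for n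
  proof (induction n)
    case 0 thus ?case by (simp add: S_def)
  next
    case (Suc n)
    thus ?case using image_S[of n] by auto
  qed
  have card_mono_Suc: "card (S n) \<le> card (S (Suc n))" for n
    using card_image_le[OF fin, of F "Suc n"] by (simp add: image_S)
  have card_mono_S: "card (S n) \<le> card (S m)" if "n \<le> m" for n m
    using that lift_Suc_mono_le[of "\<lambda>n. card (S n)"] card_mono_Suc by simp
  have "\<exists>n0. card (S n0) \<ge> 3"
  proof (rule ccontr)
    assume "\<nexists>n0. card (S n0) \<ge> 3"
    hence "card (S n) < 3" for n by (simp add: not_le)
    hence le2: "card (S n) \<le> 2" for n by (simp add: less_Suc_eq_le numeral_3_eq_3 numeral_2_eq_2)
    \<comment> \<open>The cardinalities are nondecreasing and bounded, hence eventually equal to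
      their maximum.\<close>
    define M where "M = Max (range (\<lambda>n. card (S n)))"
    have fin_range: "finite (range (\<lambda>n. card (S n)))"
      by (rule finite_subset[of _ "{..2}"]) (use le2 in auto)
    have "M \<in> range (\<lambda>n. card (S n))" unfolding M_def by (rule Max_in[OF fin_range]) simp
    then obtain n1 where n1: "card (S n1) = M" by auto
    have "card (S n) = M" if "n \<ge> n1" for n
      using card_mono_S[OF that] n1 Max_ge[OF fin_range, of "card (S n)"] by (simp add: M_def)
    hence inj_S: "inj_on F (S (Suc n))" if "n \<ge> n1" for n
      using that by (intro eq_card_imp_inj_on[OF fin]) (simp add: image_S)
    \<comment> \<open>On late levels \<open>F\<close> is injective, so their points have fibres of
      one point, while some other fibre has at least two.\<close>
    have sub: "S n \<subseteq> branch F" if "n \<ge> n1" for n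
    proof
      fix y assume y: "y \<in> S n"
      obtain x x' where x: "x \<noteq> x'" "F x = F x'" using False by (auto simp: inj_def)
      have "card {x, x'} \<le> card (F -` {F x})"
        by (rule card_mono[OF ratmap_finite_fibre[OF F(1) d0]]) (use x in auto)
      hence "2 \<le> card (F -` {F x})" using x(1) by simp
      moreover have "card (F -` {y}) \<le> 1"
      proof -
        have "F -` {y} \<subseteq> S (Suc n)" unfolding S_Suc using y by auto
        hence "inj_on F (F -` {y})" using inj_S[OF that] by (rule inj_on_subset[rotated])
        moreover have "F ` (F -` {y}) \<subseteq> {y}" by auto
        ultimately show ?thesis using card_inj_on_le[of F "F -` {y}" "{y}"] by simp
      qed
      ultimately have "card (F -` {y}) < card (F -` {F x})" by simp
      thus "y \<in> branch F" unfolding branch_def by blast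
    qed
    have "S n \<subseteq> (\<Union>n<n1. S n) \<union> branch F" for n using sub[of n] by (cases "n < n1") auto
    hence "(\<Union>n. S n) \<subseteq> (\<Union>n<n1. S n) \<union> branch F" by (rule UN_least)
    hence fin_backward: "finite (\<Union>n. S n)"
      by (rule finite_subset) (simp add: fin finite_branch[OF F(1) d0])
    \<comment> \<open>Infinitely many nonempty levels in a finite set cannot be disjoint; a common
      point of two levels makes \<open>\<beta>\<close> periodic, so the total orbit is
      finite.\<close>
    have "\<exists>n m. n < m \<and> S n \<inter> S m \<noteq> {}"
    proof (rule ccontr)
      assume disj: "\<not> ?thesis"
      have "\<forall>n. \<exists>x. x \<in> S n" using nonempty by blast
      then obtain s where s: "\<And>n. s n \<in> S n" using choice[of "\<lambda>n x. x \<in> S n"] by blast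
      have "inj s"
      proof (rule injI)
        fix i j assume eq: "s i = s j"
        show "i = j" using disj s[of i] s[of j] unfolding eq by (metis IntI empty_iff nat_neq_iff)
      qed
      moreover have "range s \<subseteq> (\<Union>n. S n)" using s by auto
      ultimately show False using fin_backward by (meson finite_subset range_inj_infinite)
    qed
    then obtain n m x where nm: "n < m" "x \<in> S n" "x \<in> S m" by blast
    define t where "t = m - n"
    have "m = t + n" using nm(1) by (simp add: t_def)
    hence "(F ^^ t) ((F ^^ n) x) = \<beta>" using nm(3) by (simp add: S_def funpow_add)
    hence period: "(F ^^ t) \<beta> = \<beta>" using nm(2) by (simp add: S_def)
    have t: "t > 0" using nm(1) by (simp add: t_def)
    have period': "(F ^^ (t * i)) \<beta> = \<beta>" for i
      by (induction i) (simp_all add: funpow_add period)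
    have "(F ^^ i) \<beta> \<in> (\<lambda>i. (F ^^ i) \<beta>) ` {..<t}" for i
    proof -
      have "i = i mod t + t * (i div t)" by simp
      hence "(F ^^ i) \<beta> = (F ^^ (i mod t)) \<beta>" by (metis funpow_add comp_apply period')
      thus ?thesis using t by simp
    qed
    hence "{\<gamma>. \<exists>n. (F ^^ n) \<beta> = \<gamma> \<or> (F ^^ n) \<gamma> = \<beta>} \<subseteq> (\<lambda>i. (F ^^ i) \<beta>) ` {..<t} \<union> (\<Union>n. S n)"
      by (auto simp: S_def)
    hence "finite {\<gamma>. \<exists>n. (F ^^ n) \<beta> = \<gamma> \<or> (F ^^ n) \<gamma> = \<beta>}"
      using fin_backward by (meson finite_Un finite_imageI finite_lessThan finite_subset)
    thus False using infinite_orbit by simp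
  qed
  then obtain n0 where n0: "card (S n0) \<ge> 3" by blast
  have three: "\<exists>x y z. {x, y, z} \<subseteq> S n \<and> x \<noteq> y \<and> x \<noteq> z \<and> y \<noteq> z" if "n \<ge> n0" for n
  proof -
    have "card (S n) \<ge> 3" using card_mono_S[OF that] n0 by simp
    from obtain_three[OF fin this] show ?thesis by (metis empty_subsetI insert_subset)
  qed
  \<comment> \<open>The fibres over three points of \<open>S n\<close> lie in \<open>W\<close>, so
    the structure through these points pulls back to \<open>W\<close>; it contains
    \<open>S n\<close> because \<open>F\<close> maps \<open>S (Suc n)\<close> onto
    \<open>S n\<close>.\<close>
  have down: "\<exists>U. k_structure U \<and> S n \<subseteq> U \<and> F -` U = W" if n: "n \<ge> n0" and W: "k_structure W" "S (Suc n) \<subseteq> W" for n W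
  proof -
    obtain x y z where xyz: "{x, y, z} \<subseteq> S n" "x \<noteq> y" "x \<noteq> z" "y \<noteq> z" using three[OF n] by blast
    obtain U where U: "k_structure U" "{x, y, z} \<subseteq> U"
      "\<And>d F W. ratmap d F \<Longrightarrow> d > 0 \<Longrightarrow> k_structure W \<Longrightarrow> F -` {x, y, z} \<subseteq> W \<Longrightarrow> F -` U = W"
      using k_structure_through_three[OF xyz(2-4)] by blast
    have "F -` {x, y, z} \<subseteq> W" using xyz(1) W(2) unfolding S_Suc by blast
    hence "F -` U = W" using U(3)[OF F(1) d0 W(1)] by blast
    moreover have "S n \<subseteq> U" using W(2) \<open>F -` U = W\<close> unfolding image_S[of n, symmetric] by blast
    ultimately show ?thesis using U(1) by blast
  qed
  have ex: "\<exists>W. k_structure W \<and> S n \<subseteq> W" if "n \<ge> n0" for n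
  proof -
    obtain m where m: "m \<ge> n" "\<exists>W. k_structure W \<and> S m \<subseteq> W" using often[of n] unfolding S_def by blast
    from m show ?thesis
    proof (induction rule: inc_induct)
      case base thus ?case by blast
    next
      case (step i)
      thus ?case using down[of i] that by (metis le_trans)
    qed
  qed
  have "\<forall>n. \<exists>W. k_structure W \<and> S (n0 + n) \<subseteq> W" using ex by simp
  from choice[OF this] obtain W where W: "\<And>n. k_structure (W n) \<and> S (n0 + n) \<subseteq> W n" by blast
  have "F -` W n = W (Suc n)" for n
  proof -
    obtain U where U: "k_structure U" "S (n0 + n) \<subseteq> U" "F -` U = W (Suc n)"
      using down[of "n0 + n" "W (Suc n)"] W[of "Suc n"] by auto
    obtain x y z where xyz: "{x, y, z} \<subseteq> S (n0 + n)" "x \<noteq> y" "x \<noteq> z" "y \<noteq> z" using three[of "n0 + n"] by auto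
    \<comment> \<open>The structures were chosen independently at each level; uniqueness through
      three points makes them compatible.\<close>
    have "U = W n" by (rule k_structure_eq[OF U(1) _ xyz(2-4)]) (use W[of n] xyz(1) U(2) in auto)
    thus ?thesis using U(3) by simp
  qed
  thus ?thesis using k_invariant_if_tower[OF F, of W] W by blast
qed

end

section \<open>Rational functions and the main theorem\<close>

text \<open>A Bezout identity, unlike coprimality itself, passes directly to the algebraic closure.
  The Euclidean measure places 0 below the nonzero constants.\<close>

lemma bezout_if_coprime:
  fixes f g :: "'a::field poly"
  assumes "coprime f g" shows "\<exists>x y. x * f + y * g = 1"
  using assms
proof (induction "if g = 0 then 0 else Suc (degree g)" arbitrary: f g rule: less_induct)
  case less
  show ?case
  proof (cases "g = 0")
    case True
    hence "f dvd 1" using less.prems by simp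
    then obtain x where "1 = f * x" by (rule dvdE)
    thus ?thesis using True by (intro exI[of _ x] exI[of _ 0]) (simp add: mult.commute)
  next
    case False
    define r where "r = f mod g"
    have f: "f = f div g * g + r" by (simp add: r_def)
    have "(if r = 0 then 0 else Suc (degree r)) < (if g = 0 then 0 else Suc (degree g))"
      using degree_mod_less[OF False, of f] False by (auto simp: r_def)
    moreover have "coprime g r"
    proof (rule coprimeI)
      fix c assume c: "c dvd g" "c dvd r"
      hence "c dvd f div g * g + r" by simp
      hence "c dvd f" by (simp add: r_def)
      thus "is_unit c" using less.prems c(1) coprime_common_divisor by blast
    qed
    ultimately obtain x y where "x * g + y * r = 1" using less.hyps by blast
    hence "y * f + (x - y * (f div g)) * g = 1" by (subst f) (simp add: algebra_simps)
    thus ?thesis by blast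
  qed
qed

lemma ratfun_lowest_terms:
  "\<phi> = Fraction_Field.Fract (ratfun_num \<phi>) (ratfun_den \<phi>)" (is ?A)
  "coprime (ratfun_num \<phi>) (ratfun_den \<phi>)" (is ?B)
  "lead_coeff (ratfun_den \<phi>) = 1" (is ?C)
proof -
  have "(case ratfun_lowest_terms \<phi> of (f, g) \<Rightarrow>
      \<phi> = Fraction_Field.Fract f g \<and> coprime f g \<and> lead_coeff g = 1)"
    unfolding ratfun_lowest_terms_def by (rule theI'[OF ratfun_lowest_terms_ex1])
  thus ?A ?B ?C by (auto simp: ratfun_num_def ratfun_den_def split: prod.splits)
qed

lemma ratfun_num_den_eqI:
  assumes "\<phi> = Fraction_Field.Fract f g" "coprime f g" "lead_coeff g = 1"
  shows "ratfun_num \<phi> = f" "ratfun_den \<phi> = g"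
proof -
  obtain p where p: "\<And>f g. \<phi> = Fraction_Field.Fract f g \<Longrightarrow> coprime f g \<Longrightarrow> lead_coeff g = 1 \<Longrightarrow> (f, g) = p"
    using ratfun_lowest_terms_ex1[of \<phi>] by (auto simp: Ex1_def)
  have "(f, g) = (ratfun_num \<phi>, ratfun_den \<phi>)"
    using p[OF assms] p[OF ratfun_lowest_terms] by simp
  thus "ratfun_num \<phi> = f" "ratfun_den \<phi> = g" by auto
qed

lemma ratfun_lowest_terms_degree:
  "lowest_terms (ratfun_degree \<phi>) (ratfun_num \<phi>) (ratfun_den \<phi>)"
  using ratfun_lowest_terms(2)[of \<phi>] by (simp add: lowest_terms_def ratfun_degree_def)

lemma ratfun_eval_eq_ev:
  "ratfun_eval \<phi> = ev (ratfun_degree \<phi>) (ratfun_num \<phi>) (ratfun_den \<phi>)"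
  by (auto simp: ratfun_eval_def ev_def pt_def Let_def split: P1.split)

lemma ratmap_ratfun_eval: "ratmap (ratfun_degree \<phi>) (ratfun_eval \<phi>)"
  using ratfun_lowest_terms_degree ratfun_eval_eq_ev unfolding ratmap_def by blast

lemma ratfun_Fract:
  fixes f g :: "'a::alg_closed_field poly"
  assumes "lowest_terms d f g" "g \<noteq> 0"
  defines "c \<equiv> inverse (lead_coeff g)"
  shows "ratfun_num (Fraction_Field.Fract f g) = smult c f" (is ?A)
    "ratfun_den (Fraction_Field.Fract f g) = smult c g" (is ?B)
    "ratfun_degree (Fraction_Field.Fract f g) = d" (is ?C)
    "ratfun_eval (Fraction_Field.Fract f g) = ev d f g" (is ?D)
proof -
  have c: "c \<noteq> 0" using assms(2) by (simp add: c_def)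
  have lt: "lowest_terms d (smult c f) (smult c g)" by (rule lowest_terms_smult[OF c assms(1)])
  have eq: "Fraction_Field.Fract f g = Fraction_Field.Fract (smult c f) (smult c g)"
    using c assms(2) by (simp add: eq_fract)
  have *: "coprime (smult c f) (smult c g)" "lead_coeff (smult c g) = 1"
    using lt assms(2) by (auto simp: lowest_terms_def c_def)
  show A: ?A and B: ?B using ratfun_num_den_eqI[OF eq *] by simp_all
  show C: ?C using lt unfolding ratfun_degree_def A B by (simp add: lowest_terms_def)
  show ?D unfolding ratfun_eval_eq_ev A B C by (rule ev_smult[OF c])
qed

lemma lowest_terms_nonzero:
  assumes "lowest_terms d f g" "d > 0" shows "f \<noteq> 0" "g \<noteq> (0 :: 'a::field poly)"
  using lowest_terms_combination_nonzero[OF assms, of 0 1] lowest_terms_combination_nonzero[OF assms, of 1 0] by auto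

lemma ratmap_imp_ratfun:
  fixes F :: "'a::alg_closed_field P1 \<Rightarrow> 'a P1"
  assumes "ratmap d F" "d > 0"
  obtains \<phi> where "ratfun_degree \<phi> = d" "ratfun_eval \<phi> = F"
proof -
  obtain f g where fg: "lowest_terms d f g" "F = ev d f g" using assms(1) by (auto simp: ratmap_def)
  show ?thesis
    using ratfun_Fract(3,4)[OF fg(1) lowest_terms_nonzero(2)[OF fg(1) assms(2)]] that fg(2) by blast
qed

lemma poly_map_to_fract:
  assumes "degree f \<le> d" "v \<noteq> 0"
  shows "poly (map_poly (\<lambda>c. to_fract [:c:]) f) (Fraction_Field.Fract u v) * to_fract v ^ d =
    to_fract (homog_poly d f u (v :: 'a::field poly))"
proof -
  let ?f = "map_poly (\<lambda>c. to_fract [:c:]) f"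
  have power: "to_fract (p ^ n) = to_fract p ^ n" for p :: "'a poly" and n
    by (induction n) (simp_all add: to_fract_mult)
  have V: "to_fract v \<noteq> 0" using assms(2) by simp
  have coeff: "coeff ?f i = to_fract [:coeff f i:]" for i by (simp add: coeff_map_poly)
  have "degree ?f \<le> d" using assms(1) degree_map_poly_le order.trans by blast
  hence "poly ?f (Fraction_Field.Fract u v) = homog d ?f (Fraction_Field.Fract u v) 1"
    by (simp add: homog_y1)
  also have "\<dots> * to_fract v ^ d = (\<Sum>i\<le>d. to_fract [:coeff f i:] * to_fract u ^ i * to_fract v ^ (d - i))"
    unfolding homog_def sum_distrib_right
  proof (rule sum.cong)
    fix i assume i: "i \<in> {..d}"
    hence "to_fract v ^ d = to_fract v ^ i * to_fract v ^ (d - i)" by (simp flip: power_add)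
    thus "coeff ?f i * Fraction_Field.Fract u v ^ i * 1 ^ (d - i) * to_fract v ^ d =
        to_fract [:coeff f i:] * to_fract u ^ i * to_fract v ^ (d - i)"
      using V by (simp add: coeff Fract_conv_to_fract power_divide)
  qed simp
  also have "\<dots> = to_fract (homog_poly d f u v)"
    by (simp add: homog_poly_def to_fract_sum flip: to_fract_mult power)
  finally show ?thesis .
qed

text \<open>Multiplying numerator and denominator by the same power of \<open>v\<close> clears
  denominators and leaves a pair already in lowest terms.\<close>

lemma ratfun_comp_props:
  fixes \<phi> \<psi> :: "'a::alg_closed_field ratfun"
  assumes "ratfun_degree \<phi> > 0" "ratfun_degree \<psi> > 0"
  shows "ratfun_degree (ratfun_comp \<phi> \<psi>) = ratfun_degree \<phi> * ratfun_degree \<psi>"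
    "ratfun_eval (ratfun_comp \<phi> \<psi>) = ratfun_eval \<phi> \<circ> ratfun_eval \<psi>"
proof -
  define d e f g u v where "d = ratfun_degree \<phi>" and "e = ratfun_degree \<psi>"
    and "f = ratfun_num \<phi>" and "g = ratfun_den \<phi>" and "u = ratfun_num \<psi>" and "v = ratfun_den \<psi>"
  note defs = d_def e_def f_def g_def u_def v_def
  have fg: "lowest_terms d f g" and uv: "lowest_terms e u v"
    unfolding defs by (rule ratfun_lowest_terms_degree)+
  have \<psi>: "\<psi> = Fraction_Field.Fract u v" unfolding defs by (rule ratfun_lowest_terms(1))
  have v: "v \<noteq> 0" by (rule lowest_terms_nonzero[OF uv]) (use assms in \<open>simp add: defs\<close>)
  define F G where "F = homog_poly d f u v" and "G = homog_poly d g u v"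
  have FG: "lowest_terms (d * e) F G" unfolding F_def G_def by (rule lowest_terms_comp[OF fg uv])
  have G: "G \<noteq> 0" by (rule lowest_terms_nonzero[OF FG]) (use assms in \<open>simp add: defs\<close>)
  define V where "V = to_fract v ^ d"
  have V: "V \<noteq> 0" using v by (simp add: V_def)
  have "ratfun_comp \<phi> \<psi> = (poly (map_poly (\<lambda>c. to_fract [:c:]) f) \<psi> * V) / (poly (map_poly (\<lambda>c. to_fract [:c:]) g) \<psi> * V)"
    using V by (simp add: ratfun_comp_def f_def g_def)
  also have "\<dots> = to_fract F / to_fract G"
    unfolding \<psi> V_def F_def G_def
    by (simp only: poly_map_to_fract[OF lowest_terms_degree(1)[OF fg] v] poly_map_to_fract[OF lowest_terms_degree(2)[OF fg] v])
  finally have comp: "ratfun_comp \<phi> \<psi> = Fraction_Field.Fract F G" by (simp add: Fract_conv_to_fract)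
  show "ratfun_degree (ratfun_comp \<phi> \<psi>) = ratfun_degree \<phi> * ratfun_degree \<psi>"
    unfolding comp ratfun_Fract(3)[OF FG G] by (simp add: defs)
  show "ratfun_eval (ratfun_comp \<phi> \<psi>) = ratfun_eval \<phi> \<circ> ratfun_eval \<psi>"
    unfolding comp ratfun_Fract(4)[OF FG G] unfolding F_def G_def ev_comp[OF fg uv]
    by (simp add: ratfun_eval_eq_ev defs)
qed

lemma ratfun_degree_to_ac:
  fixes \<phi> :: "'k::field ratfun"
  shows "ratfun_degree (ratfun_to_ac \<phi>) = ratfun_degree \<phi>"
proof -
  interpret hom: field_hom "to_ac :: 'k \<Rightarrow> _" by unfold_locales auto
  interpret map_hom: map_poly_idom_hom "to_ac :: 'k \<Rightarrow> _" ..
  define f g where "f = ratfun_num \<phi>" and "g = ratfun_den \<phi>"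
  have fg: "coprime f g" "lead_coeff g = 1" unfolding f_def g_def by (rule ratfun_lowest_terms(2,3))+
  obtain x y where "x * f + y * g = 1" using bezout_if_coprime[OF fg(1)] by blast
  hence "map_poly to_ac (x * f + y * g) = 1" by simp
  hence bez: "map_poly to_ac x * map_poly to_ac f + map_poly to_ac y * map_poly to_ac g = 1"
    by (simp only: map_hom.hom_add map_hom.hom_mult)
  have "coprime (map_poly to_ac f) (map_poly to_ac g)"
  proof (rule coprimeI)
    fix c assume c: "c dvd map_poly to_ac f" "c dvd map_poly to_ac g"
    hence "c dvd map_poly to_ac x * map_poly to_ac f + map_poly to_ac y * map_poly to_ac g" by simp
    thus "is_unit c" by (simp only: bez)
  qed
  moreover have "lead_coeff (map_poly to_ac g) = 1" using fg(2) by simp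
  ultimately have nd: "ratfun_num (ratfun_to_ac \<phi>) = map_poly to_ac f" "ratfun_den (ratfun_to_ac \<phi>) = map_poly to_ac g"
    using ratfun_num_den_eqI[of "ratfun_to_ac \<phi>"] by (simp_all add: ratfun_to_ac_def f_def g_def)
  show ?thesis unfolding ratfun_degree_def nd by (simp add: f_def g_def)
qed

context alg_closed_char_p
begin

text \<open>The cross difference of the two fractions vanishes on an infinite field, hence is the
  zero polynomial.\<close>

lemma ratfun_eval_inject:
  fixes \<phi> \<psi> :: "'a ratfun"
  assumes "ratfun_eval \<phi> = ratfun_eval \<psi>" shows "\<phi> = \<psi>"
proof -
  define f g u v where "f = ratfun_num \<phi>" and "g = ratfun_den \<phi>" and "u = ratfun_num \<psi>" and "v = ratfun_den \<psi>"
  note defs = f_def g_def u_def v_def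
  have "poly (f * v - u * g) z = 0" for z
  proof -
    have "pt (poly f z) (poly g z) = pt (poly u z) (poly v z)"
      using fun_cong[OF assms, of "Fin z"] by (simp add: ratfun_eval_eq_ev ev_Fin defs)
    hence "poly v z * poly f z = poly u z * poly g z"
      using lowest_terms_poly[OF ratfun_lowest_terms_degree] unfolding defs by (subst (asm) pt_eq_iff)
    thus ?thesis by (simp add: mult.commute)
  qed
  hence "{z. poly (f * v - u * g) z = 0} = UNIV" by blast
  hence "f * v - u * g = 0" using poly_roots_finite infinite_k by (metis finite_subset subset_UNIV)
  moreover have "g \<noteq> 0" "v \<noteq> 0" unfolding defs using ratfun_lowest_terms(3)
    by (metis coeff_0 zero_neq_one)+
  ultimately have "Fraction_Field.Fract f g = Fraction_Field.Fract u v" by (simp add: eq_fract)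
  thus ?thesis unfolding defs by (simp flip: ratfun_lowest_terms(1))
qed

lemma ratfun_eval_id:
  "ratfun_eval (ratfun_id :: 'a ratfun) = id"
proof -
  have lt: "lowest_terms 1 [:0, 1:] (1 :: 'a poly)" by (simp add: lowest_terms_def)
  have "ratfun_id = Fraction_Field.Fract [:0, 1 :: 'a:] 1" by (simp add: ratfun_id_def to_fract_def)
  moreover have "ev 1 [:0, 1:] (1 :: 'a poly) = id"
    by (auto simp: ev_def pt_def split: P1.split)
  ultimately show ?thesis using ratfun_Fract(4)[OF lt] by simp
qed

text \<open>In coordinates with \<open>W\<close> equal to \<open>Pk\<close>, the fibres over 0, 1
  and infinity lie in \<open>Pk\<close>, so the map is over \<open>k\<close>; injectivity of
  evaluation turns this into identities of rational functions.\<close>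

lemma k_invariant_imp_conj_over_k:
  fixes \<Phi> :: "'a ratfun"
  assumes "ratfun_degree \<Phi> > 0" "k_invariant (ratfun_eval \<Phi>)"
  shows "\<exists>\<sigma> \<tau>. ratfun_degree \<sigma> = 1 \<and> ratfun_comp \<sigma> \<tau> = ratfun_id \<and> ratfun_comp \<tau> \<sigma> = ratfun_id \<and>
    ratfun_comp (ratfun_comp \<sigma> \<Phi>) \<tau> \<in> ratfuns_over k"
proof -
  obtain W where W: "k_structure W" "ratfun_eval \<Phi> -` W = W" using assms(2) by (auto simp: k_invariant_def)
  then obtain s where s: "ratmap 1 s" "W = s -` Pk" by (auto simp: k_structure_def)
  obtain t where t: "ratmap 1 t" "s \<circ> t = id" "t \<circ> s = id" using s(1) by (rule ratmap_1_inverse)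
  obtain \<sigma> where \<sigma>: "ratfun_degree \<sigma> = 1" "ratfun_eval \<sigma> = s" using ratmap_imp_ratfun[OF s(1)] by auto
  obtain \<tau> where \<tau>: "ratfun_degree \<tau> = 1" "ratfun_eval \<tau> = t" using ratmap_imp_ratfun[OF t(1)] by auto
  have id: "ratfun_comp \<sigma> \<tau> = ratfun_id" "ratfun_comp \<tau> \<sigma> = ratfun_id"
    using \<sigma> \<tau> t(2,3) by (auto intro!: ratfun_eval_inject simp: ratfun_comp_props ratfun_eval_id)
  define G where "G = s \<circ> ratfun_eval \<Phi> \<circ> t"
  have eval: "ratfun_eval (ratfun_comp (ratfun_comp \<sigma> \<Phi>) \<tau>) = G"
    using assms(1) \<sigma> \<tau> by (simp add: ratfun_comp_props G_def)
  have G: "ratmap (ratfun_degree \<Phi>) G" unfolding G_def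
    by (intro ratmap_comp_left ratmap_comp_right ratmap_ratfun_eval s t)
  have "G -` Pk = t -` (ratfun_eval \<Phi> -` (s -` Pk))" by (auto simp: G_def)
  also have "\<dots> = (s \<circ> t) -` Pk" unfolding s(2)[symmetric] W(2) by (simp add: s(2) vimage_comp)
  finally have "G -` Pk = Pk" by (simp add: t)
  hence "G -` {Fin 0, Fin 1, Infty} \<subseteq> Pk" by force
  then obtain f g where fg: "lowest_terms (ratfun_degree \<Phi>) f g" "G = ev (ratfun_degree \<Phi>) f g" "over_k f" "over_k g"
    using over_k_if_fibres_in_Pk[OF G assms(1)] by blast
  have g: "g \<noteq> 0" by (rule lowest_terms_nonzero[OF fg(1) assms(1)])
  have "ratfun_comp (ratfun_comp \<sigma> \<Phi>) \<tau> = Fraction_Field.Fract f g"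
    by (rule ratfun_eval_inject) (simp only: eval fg(2) ratfun_Fract(4)[OF fg(1) g])
  hence "ratfun_comp (ratfun_comp \<sigma> \<Phi>) \<tau> \<in> ratfuns_over k"
    using fg(3,4) g unfolding ratfuns_over_def over_k_def by blast
  thus ?thesis using \<sigma>(1) id by blast
qed

end

text \<open>The relation \<open>p = 0\<close> is carried along the field homomorphism.\<close>

lemma CHAR_finite_field_extension:
  fixes \<iota> :: "'p::prime_card mod_ring poly fract \<Rightarrow> 'k::field"
  assumes "finite_field_extension \<iota>" shows "CHAR('k) > 0"
proof -
  interpret field_hom \<iota> using assms by (simp add: finite_field_extension_def)
  have of_nat: "(of_nat n :: 'p mod_ring poly fract) = to_fract (of_nat n)" for n
    by (induction n) simp_all
  have "(of_nat CARD('p) :: 'p mod_ring poly) = 0"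
    by (simp add: of_nat_eq_0_iff_char_dvd)
  hence "\<iota> (of_nat CARD('p)) = 0" by (simp add: of_nat)
  hence "(of_nat CARD('p) :: 'k) = 0" by (simp add: hom_of_nat)
  moreover have "CARD('p) > 0" by (simp add: card_gt_0_iff)
  ultimately show ?thesis unfolding CHAR_pos_iff by blast
qed

theorem theorem3p1:
  fixes \<iota> :: "'p::prime_card mod_ring poly fract \<Rightarrow> 'k::field"
    and \<phi> :: "'k ratfun"
    and \<beta> :: "'k P1"
  assumes "finite_field_extension \<iota>"
    and "ratfun_degree \<phi> > 1"
    and "\<not> isotrivial \<phi>"
    and "\<not> exceptional \<phi> \<beta>"
  shows "\<exists>N. \<forall>n\<ge>N. \<not> isotrivial_set (iterated_preimage \<phi> n \<beta>)"
proof (rule ccontr)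
  assume contra: "\<nexists>N. \<forall>n\<ge>N. \<not> isotrivial_set (iterated_preimage \<phi> n \<beta>)"
  interpret alg_closed_char_p "TYPE('k alg_closure)"
    by unfold_locales (use CHAR_finite_field_extension[OF assms(1)] in simp)
  define F where "F = ratfun_eval (ratfun_to_ac \<phi>)"
  have deg: "ratfun_degree (ratfun_to_ac \<phi>) > 1" using assms(2) by (simp add: ratfun_degree_to_ac)
  \<comment> \<open>The Moebius map witnessing isotriviality of a preimage pulls \<open>Pk\<close>
    back to a structure containing that preimage.\<close>
  have "\<exists>n\<ge>N. \<exists>W. k_structure W \<and> (F ^^ n) -` {P1_to_ac \<beta>} \<subseteq> W" for N
  proof -
    obtain n where n: "n \<ge> N" "isotrivial_set (iterated_preimage \<phi> n \<beta>)" using contra by blast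
    then obtain \<sigma> where \<sigma>: "ratfun_degree \<sigma> = 1" "ratfun_eval \<sigma> ` iterated_preimage \<phi> n \<beta> \<subseteq> Pk"
      unfolding isotrivial_set_def Pk_def by blast
    have "ratmap 1 (ratfun_eval \<sigma>)" using ratmap_ratfun_eval[of \<sigma>] \<sigma>(1) by simp
    hence "k_structure (ratfun_eval \<sigma> -` Pk)" by (rule k_structure_vimage_Pk)
    moreover have "(F ^^ n) -` {P1_to_ac \<beta>} = iterated_preimage \<phi> n \<beta>"
      by (auto simp: iterated_preimage_def F_def)
    ultimately show ?thesis using \<sigma>(2) n(1) by blast
  qed
  moreover have "infinite {\<gamma>. \<exists>n. (F ^^ n) (P1_to_ac \<beta>) = \<gamma> \<or> (F ^^ n) \<gamma> = P1_to_ac \<beta>}"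
    using assms(4) by (simp add: exceptional_def F_def)
  ultimately have "k_invariant F"
    using k_invariant_if_preimages_in_k_structures[OF _ deg, of F] ratmap_ratfun_eval[of "ratfun_to_ac \<phi>"]
    unfolding F_def by blast
  hence "isotrivial \<phi>"
    using k_invariant_imp_conj_over_k[of "ratfun_to_ac \<phi>"] deg unfolding F_def isotrivial_def by simp
  thus False using assms(3) by simp
qed

end
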